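(* Let $N\geq 3$, let $D=\{\delta_1,\ldots,\delta_N\}\subset(0,1)$ with $\delta_i\neq\delta_j$ for $i\neq j$, and let $\succeq$ be a weak order on $\ell_\infty$. The following conditions are equivalent. (i) The relation $\succeq$ satisfies D-monotonicity (parts (a) and (b)), Continuity, Convexity (parts (a) and (b)), Invariance with respect to generation $0$'s origin, and Invariance with respect to unconcerned individuals. (ii) There exist a probability measure $\nu\in\Delta_{++}(D)$ and $\sigma\in(0,\infty)$ such that for all $x,y\in\ell_\infty$, $$x\succeq y\iff \sum_{\delta\in D}\xi_\sigma(\langle\delta,x\rangle)\nu(\delta)\geq\sum_{\delta\in D}\xi_\sigma(\langle\delta,y\rangle)\nu(\delta),$$ where $\xi_\sigma(t)=-\exp(-t/\sigma)$ for $t\in\mathbb{R}$.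
   Context: $\mathbb{T}=\{0,1,2,\ldots\}$. $\ell_\infty$ is the space of bounded real sequences $x=(x_t)_{t\in\mathbb{T}}$ with the supremum norm $\|x\|_\infty=\sup_t|x_t|$. For $\delta\in(0,1)$, $\langle\delta,x\rangle=\sum_{t\in\mathbb{T}}\delta^t x_t$. A weak order is a complete and transitive binary relation; $\succ$ and $\sim$ are the asymmetric and symmetric parts of $\succeq$. Let $\ell_\infty^0=\{(z_0,z_1,\ldots)\in\ell_\infty: z_t=0\ \forall t\geq 1\}$. $\Delta_{++}(D)$ is the set of probability measures $\mu$ on $D$ with $\mu(\delta)>0$ for every $\delta\in D$. For $E\subset D$, $E^c=D\setminus E$. Axioms: - D-monotonicity: for all $x,y\in\ell_\infty$, (a) if $\langle\delta,x\rangle\geq\langle\delta,y\rangle$ for all $\delta\in D$, then $x\succeq y$; and (b) if, additionally, $\langle\delta,x\rangle>\langle\delta,y\rangle$ for some $\delta\in D$, then $x\succ y$. - Continuity: for every $x\in\ell_\infty$, the sets $\{z\in\ell_\infty: z\succeq x\}$ and $\{z\in\ell_\infty: x\succeq z\}$ are closed. - Convexity: (a) for all $x,y\in\ell_\infty$, if $x\sim y$, then $\alpha x+(1-\alpha)y\succeq x$ for every $\alpha\in[0,1]$; and (b) there exist $x',y'\in\ell_\infty$ with $x'\sim y'$ and $\alpha x'+(1-\alpha)y'\succ x'$ for some $\alpha\in(0,1)$. - Invariance with respect to generation $0$'s origin: for all $x,y\in\ell_\infty$ and all $z^0\in\ell_\infty^0$, $x\succeq y$ if and only if $x+z^0\succeq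 y+z^0$. - Invariance with respect to unconcerned individuals: for any $x,y,x',y'\in\ell_\infty$ and any subset $E\subset D$, if $\langle\delta,x\rangle=\langle\delta,x'\rangle$ and $\langle\delta,y\rangle=\langle\delta,y'\rangle$ for all $\delta\in E$, and $\langle\delta,x\rangle=\langle\delta,y\rangle$ and $\langle\delta,x'\rangle=\langle\delta,y'\rangle$ for all $\delta\in E^c$, then $x\succeq y$ if and only if $x'\succeq y'$. *)

theory Defs
  imports "HOL-Analysis.Analysis" "HOL-Probability.Probability"
begin

text \<open>The type of bounded continuous functions carries the supremum norm; since \<^typ>\<open>nat\<close> has the
  discrete topology, its instance below consists of all bounded real sequences.\<close>

type_synonym linf = "nat \<Rightarrow>\<^sub>C real"

lemma range_apply_linf: "range (apply_bcontfun :: linf \<Rightarrow> nat \<Rightarrow> real) = {f. bounded (range f)}"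
proof -
  have "range (apply_bcontfun :: linf \<Rightarrow> nat \<Rightarrow> real) = bcontfun"
    by (rule type_definition.Rep_range[OF type_definition_bcontfun])
  then show ?thesis by (auto simp: bcontfun_def)
qed

lemma norm_linf: "norm (x :: linf) = (SUP t. \<bar>apply_bcontfun x t\<bar>)"
  by (simp add: norm_bcontfun_def dist_bcontfun_def)

definition discounted :: "real \<Rightarrow> linf \<Rightarrow> real" where
  "discounted \<delta> x = (\<Sum>t. \<delta> ^ t * apply_bcontfun x t)"

lemma summable_discounted:
  assumes "\<delta> \<in> {0<..<1}"
  shows "summable (\<lambda>t. \<delta> ^ t * apply_bcontfun (x :: linf) t)"
proof (rule summable_comparison_test')
  show "summable (\<lambda>t. \<delta> ^ t * norm x)"
    using assms by (intro summable_mult2 summable_geometric) auto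
  show "norm (\<delta> ^ t * apply_bcontfun x t) \<le> \<delta> ^ t * norm x" for t
    using assms norm_bounded[of x t] by (auto simp: abs_mult intro!: mult_left_mono)
qed

definition linf0 :: "linf set" where
  "linf0 = {z. \<forall>t\<ge>1. apply_bcontfun z t = 0}"

definition weak_order :: "('a \<Rightarrow> 'a \<Rightarrow> bool) \<Rightarrow> bool" where
  "weak_order R \<longleftrightarrow> (\<forall>x y. R x y \<or> R y x) \<and> (\<forall>x y z. R x y \<longrightarrow> R y z \<longrightarrow> R x z)"

definition asym_part :: "('a \<Rightarrow> 'a \<Rightarrow> bool) \<Rightarrow> 'a \<Rightarrow> 'a \<Rightarrow> bool" where
  "asym_part R x y \<longleftrightarrow> R x y \<and> \<not> R y x"

definition sym_part :: "('a \<Rightarrow> 'a \<Rightarrow> bool) \<Rightarrow> 'a \<Rightarrow> 'a \<Rightarrow> bool" where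
  "sym_part R x y \<longleftrightarrow> R x y \<and> R y x"

definition D_monotonicity :: "real set \<Rightarrow> (linf \<Rightarrow> linf \<Rightarrow> bool) \<Rightarrow> bool" where
  "D_monotonicity D R \<longleftrightarrow>
     (\<forall>x y. (\<forall>\<delta>\<in>D. discounted \<delta> x \<ge> discounted \<delta> y) \<longrightarrow>
        R x y \<and> ((\<exists>\<delta>\<in>D. discounted \<delta> x > discounted \<delta> y) \<longrightarrow> asym_part R x y))"

definition continuity :: "(linf \<Rightarrow> linf \<Rightarrow> bool) \<Rightarrow> bool" where
  "continuity R \<longleftrightarrow> (\<forall>x. closed {z. R z x} \<and> closed {z. R x z})"

definition convexity :: "(linf \<Rightarrow> linf \<Rightarrow> bool) \<Rightarrow> bool" where
  "convexity R \<longleftrightarrow>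
     (\<forall>x y. sym_part R x y \<longrightarrow> (\<forall>\<alpha>\<in>{0..1}. R (\<alpha> *\<^sub>R x + (1 - \<alpha>) *\<^sub>R y) x)) \<and>
     (\<exists>x' y'. sym_part R x' y' \<and>
        (\<exists>\<alpha>\<in>{0<..<1}. asym_part R (\<alpha> *\<^sub>R x' + (1 - \<alpha>) *\<^sub>R y') x'))"

definition invariance_origin :: "(linf \<Rightarrow> linf \<Rightarrow> bool) \<Rightarrow> bool" where
  "invariance_origin R \<longleftrightarrow> (\<forall>x y. \<forall>z\<in>linf0. R x y \<longleftrightarrow> R (x + z) (y + z))"

definition invariance_unconcerned :: "real set \<Rightarrow> (linf \<Rightarrow> linf \<Rightarrow> bool) \<Rightarrow> bool" where
  "invariance_unconcerned D R \<longleftrightarrow>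
     (\<forall>x y x' y'. \<forall>E\<subseteq>D.
        (\<forall>\<delta>\<in>E. discounted \<delta> x = discounted \<delta> x' \<and> discounted \<delta> y = discounted \<delta> y') \<and>
        (\<forall>\<delta>\<in>D - E. discounted \<delta> x = discounted \<delta> y \<and> discounted \<delta> x' = discounted \<delta> y')
        \<longrightarrow> (R x y \<longleftrightarrow> R x' y'))"

text \<open>Probability measures on the finite set \<open>D\<close> with full support are represented by probability
  mass functions on the reals that are concentrated on \<open>D\<close>.\<close>

definition full_support_measures :: "real set \<Rightarrow> real pmf set" where
  "full_support_measures D = {\<nu>. set_pmf \<nu> \<subseteq> D \<and> (\<forall>\<delta>\<in>D. pmf \<nu> \<delta> > 0)}"

definition xi :: "real \<Rightarrow> real \<Rightarrow> real" where
  "xi \<sigma> t = - exp (- t / \<sigma>)"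

end

(* Interpolating by polynomials turns the relation into a preference over utility profiles in R^D.
   There every group E has a certainty equivalent; it is translation invariant, strictly increasing
   and, since quasiconcave and translation invariant, concave. Merging two disjoint groups E and F
   with levels b and c gives b + f (c - b) for a concave increasing f. Merging three groups in two
   ways yields the associativity equation g(x) + h(x + y - g(x)) = k(x + l(y)), whose one-sided
   derivatives satisfy 1/l'(y) - 1 = g'(x) (1/h'(y + x - g(x)) - 1), an exponential equation. So all
   merging functions are quasi-arithmetic means of -exp(-B t), or of t if B = 0, with a common B,
   and induction over groups gives the representation. Strict convexity excludes B = 0. *)
theory Submission
  imports Defs
begin

subsection \<open>Concave functions on the line\<close>

text \<open>No smoothness is assumed, and this shapes the proof. Concavity supplies one-sided
  derivatives at every point, and strict monotonicity of the inner maps lets right derivatives pass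
  through compositions. Differentiating the associativity equation in \<open>y\<close> and in
  \<open>x\<close> meets the same slope of \<open>k\<close>, so \<open>k\<close> can be eliminated.
  Concavity also makes \<open>1 / h' - 1\<close> nondecreasing, which excludes irregular solutions
  of the exponential equation and yields \<open>B \<ge> 0\<close>. The third member of
  \<open>D\<close> is what makes such an equation available at all. The exponent is then carried
  from one pair of groups to the others, because the equation ties the slopes of \<open>l\<close>
  and \<open>h\<close> together by a constant factor.\<close>

definition right_deriv :: "(real \<Rightarrow> real) \<Rightarrow> real \<Rightarrow> real" where
  "right_deriv f x = (THE d. (f has_real_derivative d) (at_right x))"

lemma right_deriv_eq:
  "(f has_real_derivative d) (at_right x) \<Longrightarrow> right_deriv f x = d"
  unfolding right_deriv_def
  by (rule the_equality) (auto intro: has_field_derivative_unique[OF _ _ trivial_limit_at_right_real])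

text \<open>A strictly increasing inner function sends points to the right of \<open>x\<close> to
  points to the right of \<open>f x\<close>, so the one-sided derivative of \<open>g\<close> is
  enough.\<close>

lemma right_derivative_chain:
  fixes f g :: "real \<Rightarrow> real"
  assumes "(g has_real_derivative b) (at_right (f x))" "(f has_real_derivative a) (at_right x)"
    and "strict_mono f"
  shows "((\<lambda>t. g (f t)) has_real_derivative b * a) (at_right x)"
proof -
  have "f ` {x<..} \<subseteq> {f x<..}" using assms(3) by (auto simp: strict_mono_def)
  then have "(g has_real_derivative b) (at (f x) within f ` {x<..})"
    using assms(1) has_field_derivative_subset by blast
  from DERIV_image_chain[OF this assms(2)] show ?thesis by (simp add: o_def)
qed

text \<open>The shape of the value of two merged groups at levels 0 and \<open>y\<close>.
  Monotonicity of \<open>y - f y\<close> is monotonicity in the level of the other group.\<close>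

definition mean_fun :: "(real \<Rightarrow> real) \<Rightarrow> bool" where
  "mean_fun f \<longleftrightarrow> concave_on UNIV f \<and> strict_mono f \<and> strict_mono (\<lambda>y. y - f y) \<and> f 0 = 0"

lemma concave_slope_le:
  fixes f :: "real \<Rightarrow> real"
  assumes "concave_on UNIV f" "x < y" "y < z"
  shows "(f z - f x) / (z - x) \<le> (f y - f x) / (y - x)"
    and "(f z - f y) / (z - y) \<le> (f z - f x) / (z - x)"
proof -
  have c: "convex_on UNIV (\<lambda>x. - f x)" using assms(1) by (simp add: concave_on_def)
  have n: "(- f u - - f v) / (u - v) = - ((f v - f u) / (v - u))" for u v
    by (metis diff_minus_eq_add minus_diff_eq minus_divide_right uminus_add_conv_diff)
  show "(f z - f x) / (z - x) \<le> (f y - f x) / (y - x)"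
    using convex_on_slope_le(1)[OF c UNIV_I UNIV_I assms(2,3)] unfolding n by simp
  show "(f z - f y) / (z - y) \<le> (f z - f x) / (z - x)"
    using convex_on_slope_le(2)[OF c UNIV_I UNIV_I assms(2,3)] unfolding n by simp
qed

text \<open>As \<open>y\<close> decreases to \<open>x\<close> the chord slopes increase, and the
  chord over \<open>{x - 1..x}\<close> bounds them, so they converge. The signs are flipped because
  \<open>Lim_right_bound\<close> handles nondecreasing functions that are bounded below.\<close>

lemma concave_has_right_deriv:
  fixes f :: "real \<Rightarrow> real"
  assumes "concave_on UNIV f"
  shows "(f has_real_derivative right_deriv f x) (at_right x)"
proof -
  let ?s = "\<lambda>y. - ((f y - f x) / (y - x))"
  have "(?s \<longlongrightarrow> Inf (?s ` ({x<..} \<inter> UNIV))) (at x within ({x<..} \<inter> UNIV))"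
  proof (rule Lim_right_bound)
    fix a b assume "x < a" "a \<le> b"
    then show "?s a \<le> ?s b"
      using concave_slope_le(1)[OF assms, of x a b] by (cases "a = b") auto
  next
    fix a assume "x < a"
    then have "(f a - f x) / (a - x) \<le> (f a - f (x - 1)) / (a - (x - 1))"
      and "(f a - f (x - 1)) / (a - (x - 1)) \<le> (f x - f (x - 1)) / (x - (x - 1))"
      using concave_slope_le[OF assms, of "x - 1" x a] by auto
    then show "- ((f x - f (x - 1)) / (x - (x - 1))) \<le> ?s a" by linarith
  qed
  from tendsto_minus[OF this] show ?thesis
    using right_deriv_eq by (fastforce simp: has_field_derivative_iff)
qed

lemma concave_right_deriv_bounds:
  fixes f :: "real \<Rightarrow> real"
  assumes f: "concave_on UNIV f" and "x < y"
  shows "f y - f x \<le> right_deriv f x * (y - x)"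
    and "right_deriv f y * (y - x) \<le> f y - f x"
proof -
  have lim: "((\<lambda>t. (f t - f z) / (t - z)) \<longlongrightarrow> right_deriv f z) (at_right z)" for z
    using concave_has_right_deriv[OF f] by (simp add: has_field_derivative_iff)
  have "\<forall>\<^sub>F t in at_right x. (f y - f x) / (y - x) \<le> (f t - f x) / (t - x)"
    unfolding eventually_at_right_field using concave_slope_le(1)[OF f] \<open>x < y\<close> by blast
  then have "(f y - f x) / (y - x) \<le> right_deriv f x"
    by (rule tendsto_lowerbound[OF lim]) simp
  then show "f y - f x \<le> right_deriv f x * (y - x)"
    using \<open>x < y\<close> by (simp add: field_simps)
  have "(f t - f y) / (t - y) \<le> (f y - f x) / (y - x)" if "y < t" for t
    using concave_slope_le[OF f \<open>x < y\<close> that] by linarith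
  then have "\<forall>\<^sub>F t in at_right y. (f t - f y) / (t - y) \<le> (f y - f x) / (y - x)"
    by (simp add: eventually_at_filter)
  then have "right_deriv f y \<le> (f y - f x) / (y - x)"
    by (rule tendsto_upperbound[OF lim]) simp
  then show "right_deriv f y * (y - x) \<le> f y - f x"
    using \<open>x < y\<close> by (simp add: field_simps)
qed

lemma concave_right_deriv_antimono:
  fixes f :: "real \<Rightarrow> real"
  assumes "concave_on UNIV f" "x \<le> y"
  shows "right_deriv f y \<le> right_deriv f x"
proof (cases "x = y")
  case False
  then have "x < y" using assms(2) by simp
  then have "right_deriv f y * (y - x) \<le> right_deriv f x * (y - x)"
    using concave_right_deriv_bounds[OF assms(1), of x y] by linarith
  moreover have "y - x > 0" using False assms(2) by simp
  ultimately show ?thesis by (meson mult_le_cancel_right_pos)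
qed simp

text \<open>Each chord slope lies between the right slopes at its two ends; continuity of the right
  slope squeezes the chords from both sides and so rules out a kink.\<close>

lemma concave_has_deriv:
  fixes f :: "real \<Rightarrow> real"
  assumes f: "concave_on UNIV f" and "isCont (right_deriv f) x"
  shows "(f has_real_derivative right_deriv f x) (at x)"
proof -
  have "\<bar>(f y - f x) / (y - x) - right_deriv f x\<bar> \<le> \<bar>right_deriv f y - right_deriv f x\<bar>"
    if "y \<noteq> x" for y
  proof (cases "y < x")
    case True
    have "(f x - f y) / (x - y) \<le> right_deriv f y" "right_deriv f x \<le> (f x - f y) / (x - y)"
      using concave_right_deriv_bounds[OF f True] True by (auto simp: field_simps)
    moreover have "(f x - f y) / (x - y) = (f y - f x) / (y - x)"
      by (metis minus_diff_eq minus_divide_divide)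
    ultimately show ?thesis by auto
  next
    case False
    then have "x < y" using that by simp
    then have "(f y - f x) / (y - x) \<le> right_deriv f x" "right_deriv f y \<le> (f y - f x) / (y - x)"
      using concave_right_deriv_bounds[OF f \<open>x < y\<close>] by (auto simp: field_simps)
    then show ?thesis by auto
  qed
  then have "\<forall>\<^sub>F y in at x. norm ((f y - f x) / (y - x) - right_deriv f x)
      \<le> norm (right_deriv f y - right_deriv f x)"
    by (auto simp: eventually_at_filter)
  moreover have "((\<lambda>y. right_deriv f y - right_deriv f x) \<longlongrightarrow> 0) (at x)"
    using assms(2) by (simp add: isCont_def LIM_zero)
  ultimately have "((\<lambda>y. (f y - f x) / (y - x) - right_deriv f x) \<longlongrightarrow> 0) (at x)"
    using tendsto_0_le[where K=1] by (metis (no_types, lifting) eventually_mono mult_1_right)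
  then show ?thesis by (simp add: has_field_derivative_iff LIM_zero_cancel)
qed

text \<open>The slope at \<open>x\<close> dominates the strictly positive chord to
  \<open>x + 1\<close>, and is dominated by the chord from \<open>x - 1\<close>, which is below 1
  because \<open>y - f y\<close> increases.\<close>

lemma mean_fun_right_deriv:
  assumes "mean_fun f"
  shows "0 < right_deriv f x" "right_deriv f x < 1"
proof -
  have f: "concave_on UNIV f" and m: "strict_mono f" "strict_mono (\<lambda>y. y - f y)"
    using assms by (auto simp: mean_fun_def)
  have "f x < f (x + 1)" "(x - 1) - f (x - 1) < x - f x"
    using m by (auto simp: strict_mono_def)
  then show "0 < right_deriv f x" "right_deriv f x < 1"
    using concave_right_deriv_bounds(1)[OF f, of x "x + 1"]
      concave_right_deriv_bounds(2)[OF f, of "x - 1" x] by auto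
qed

subsection \<open>The associativity equation\<close>

text \<open>Cauchy's equation: the deviation \<open>g\<close> from the linear function is additive
  and vanishes at integers, hence has period 1. Monotonicity bounds it on the unit interval, and a
  bounded additive function is 0 by the Archimedean property.\<close>

lemma additive_mono_linear:
  fixes f :: "real \<Rightarrow> real"
  assumes add: "\<And>x y. f (x + y) = f x + f y" and mono: "mono f"
  shows "f x = f 1 * x"
proof -
  define g where "g x = f x - f 1 * x" for x
  have g_add: "g (x + y) = g x + g y" for x y by (simp add: g_def add algebra_simps)
  have g0: "g 0 = 0" using g_add[of 0 0] by simp
  have g_nat: "g (of_nat n * x) = of_nat n * g x" for n x
    by (induction n) (simp_all add: g0 g_add algebra_simps)
  have g_neg: "g (- x) = - g x" for x using g_add[of x "- x"] g0 by simp
  have "g 1 = 0" by (simp add: g_def)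
  then have g_nat0: "g (of_nat n) = 0" for n using g_nat[of n 1] by simp
  have g_int: "g (of_int k) = 0" for k
    by (cases k) (auto simp: g_nat0 g_neg simp del: of_nat_Suc)
  have "f 0 = 0" using add[of 0 0] by simp
  have bound: "\<bar>g x\<bar> \<le> f 1" for x
  proof -
    have "g x = g (frac x)" using g_add[of "of_int \<lfloor>x\<rfloor>" "frac x"] g_int by (simp add: frac_def)
    moreover have "0 \<le> frac x" "frac x \<le> 1" using frac_lt_1[of x] by auto
    moreover from this have "0 \<le> f (frac x)" "f (frac x) \<le> f 1"
      using monoD[OF mono, of 0 "frac x"] monoD[OF mono, of "frac x" 1] \<open>f 0 = 0\<close> by auto
    moreover from calculation have "f 1 * frac x \<le> f 1" "0 \<le> f 1 * frac x"
      by (auto intro: mult_left_le)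
    ultimately show ?thesis unfolding g_def by linarith
  qed
  have "g x = 0"
  proof (rule ccontr)
    assume "g x \<noteq> 0"
    then obtain n where "f 1 < of_nat n * \<bar>g x\<bar>" using reals_Archimedean3[of "\<bar>g x\<bar>"] by auto
    then show False using bound[of "of_nat n * x"] by (simp add: g_nat abs_mult)
  qed
  then show ?thesis by (simp add: g_def)
qed

text \<open>Normalised at 0, \<open>ln P\<close> becomes additive. Only shifts
  \<open>s \<ge> 0\<close> are assumed, since they will come from \<open>x - g x\<close>, which is
  unbounded above but may be bounded below; a negative increment is treated by shifting
  back.\<close>

lemma exponential_of_shifts:
  fixes P :: "real \<Rightarrow> real"
  assumes pos: "\<And>y. P y > 0" and mono: "mono P"
    and shift: "\<And>s. s \<ge> 0 \<Longrightarrow> \<exists>c. \<forall>y. P (y + s) = P y * c"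
  shows "\<exists>A>0. \<exists>B\<ge>0. \<forall>y. P y = A * exp (B * y)"
proof -
  define f where "f y = ln (P y) - ln (P 0)" for y
  have f_pos: "f (y + s) = f y + f s" if s: "s \<ge> 0" for y s
  proof -
    from shift[OF s] obtain c where c: "P (y + s) = P y * c" "P s = P 0 * c"
      by (metis add_0)
    then have "P (y + s) * P 0 = P y * P s" by simp
    then have "ln (P (y + s)) + ln (P 0) = ln (P y) + ln (P s)"
      using pos by (metis ln_mult_pos)
    then show ?thesis by (simp add: f_def)
  qed
  have f_add: "f (x + y) = f x + f y" for x y
  proof (cases "y \<ge> 0")
    case False
    have "f (x + y + - y) = f (x + y) + f (- y)" "f (y + - y) = f y + f (- y)"
      by (rule f_pos, use False in simp)+
    then show ?thesis by (simp add: f_def)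
  qed (rule f_pos)
  have f_mono: "mono f"
    using mono pos by (auto simp: f_def mono_def)
  have "P y = P 0 * exp (f 1 * y)" for y
  proof -
    have "ln (P y) = ln (P 0) + f 1 * y"
      using additive_mono_linear[OF f_add f_mono, of y] by (simp add: f_def)
    then show ?thesis by (metis exp_add exp_ln pos)
  qed
  moreover have "0 \<le> f 1" using monoD[OF f_mono, of 0 1] by (simp add: f_def)
  ultimately show ?thesis using pos by blast
qed

text \<open>\<open>1 / f' - 1\<close> is the ratio of the marginal weights of the two groups. For an
  exponential mean with weight \<open>w\<close> on \<open>y\<close> it is
  \<open>(1 - w) / w * exp (B * y)\<close>. In this form a constant factor changes \<open>A\<close>
  but keeps \<open>B\<close>.\<close>

definition exp_slope :: "real \<Rightarrow> (real \<Rightarrow> real) \<Rightarrow> bool" where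
  "exp_slope B f \<longleftrightarrow> (\<exists>A>0. \<forall>y. 1 / right_deriv f y = 1 + A * exp (B * y))"

lemma exp_slope_cong:
  assumes "c > 0" "\<And>y. 1 / right_deriv f y - 1 = c * (1 / right_deriv g y - 1)"
  shows "exp_slope B f \<longleftrightarrow> exp_slope B g"
proof -
  have f: "1 / right_deriv f y = 1 + c * (1 / right_deriv g y - 1)" for y
    using assms(2)[of y] by simp
  have g: "1 / right_deriv g y = 1 + (1 / right_deriv f y - 1) / c" for y
    using assms by simp
  show ?thesis
  proof
    assume "exp_slope B f"
    then obtain A where "A > 0" "\<And>y. 1 / right_deriv f y = 1 + A * exp (B * y)"
      by (auto simp: exp_slope_def)
    then have "A / c > 0" "\<forall>y. 1 / right_deriv g y = 1 + A / c * exp (B * y)"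
      using assms(1) by (simp_all add: g)
    then show "exp_slope B g" unfolding exp_slope_def by blast
  next
    assume "exp_slope B g"
    then obtain A where "A > 0" "\<And>y. 1 / right_deriv g y = 1 + A * exp (B * y)"
      by (auto simp: exp_slope_def)
    then have "c * A > 0" "\<forall>y. 1 / right_deriv f y = 1 + (c * A) * exp (B * y)"
      using assms(1) by (simp_all add: f)
    then show "exp_slope B f" unfolding exp_slope_def by blast
  qed
qed

context
  fixes g h k l :: "real \<Rightarrow> real"
  assumes mean: "mean_fun g" "mean_fun h" "mean_fun k" "mean_fun l"
    and assoc: "\<And>x y. g x + h (x + y - g x) = k (x + l y)"
begin

text \<open>Comparing the right derivatives of both sides in \<open>y\<close> and in \<open>x\<close> turns associativity into a
  multiplicative Pexider equation for \<open>1 / f' - 1\<close>.\<close>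

lemma assoc_slopes:
  "1 / right_deriv l y - 1 = right_deriv g x * (1 / right_deriv h (y + (x - g x)) - 1)"
proof -
  note d = concave_has_right_deriv
  have c: "concave_on UNIV g" "concave_on UNIV h" "concave_on UNIV k" "concave_on UNIV l"
    and m: "strict_mono l" "strict_mono (\<lambda>x. x - g x)"
    using mean by (auto simp: mean_fun_def)
  let ?G = "right_deriv g x" and ?H = "right_deriv h (y + (x - g x))"
    and ?K = "right_deriv k (x + l y)" and ?L = "right_deriv l y"
  have "((\<lambda>t. h (t + (x - g x))) has_real_derivative ?H * 1) (at_right y)"
    by (rule right_derivative_chain[OF d[OF c(2)]])
      (auto intro!: derivative_eq_intros strict_monoI)
  then have "((\<lambda>t. g x + h (x + t - g x)) has_real_derivative ?H) (at_right y)"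
    by (auto intro!: derivative_eq_intros simp: algebra_simps)
  moreover have "((\<lambda>t. k (x + l t)) has_real_derivative ?K * ?L) (at_right y)"
    by (rule right_derivative_chain[OF d[OF c(3)]])
      (use d[OF c(4)] m(1) in \<open>auto intro!: derivative_eq_intros strict_monoI simp: strict_mono_def\<close>)
  ultimately have HL: "?H = ?K * ?L"
    unfolding assoc by (rule has_field_derivative_unique[OF _ _ trivial_limit_at_right_real])
  have "((\<lambda>t. h (y + (t - g t))) has_real_derivative ?H * (1 - ?G)) (at_right x)"
    by (rule right_derivative_chain[OF d[OF c(2)]])
      (use d[OF c(1)] m(2) in \<open>auto intro!: derivative_eq_intros strict_monoI simp: strict_mono_def\<close>)
  then have "((\<lambda>t. g t + h (t + y - g t)) has_real_derivative ?G + ?H * (1 - ?G)) (at_right x)"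
    using d[OF c(1), of x] by (auto intro!: derivative_eq_intros simp: algebra_simps)
  moreover have "((\<lambda>t. k (t + l y)) has_real_derivative ?K * 1) (at_right x)"
    by (rule right_derivative_chain[OF d[OF c(3)]])
      (auto intro!: derivative_eq_intros strict_monoI)
  ultimately have GK: "?G + ?H * (1 - ?G) = ?K * 1"
    unfolding assoc by (rule has_field_derivative_unique[OF _ _ trivial_limit_at_right_real])
  have pos: "?H > 0" "?K > 0" "?L > 0" using mean by (auto intro: mean_fun_right_deriv)
  \<comment> \<open>\<open>?K\<close> is the only trace of \<open>k\<close>: it is replaced here by
    its value from the derivative in \<open>x\<close>.\<close>
  have "1 / ?L = ?K / ?H" using HL pos by simp
  also have "\<dots> = (?G + ?H * (1 - ?G)) / ?H" using GK by simp
  also have "\<dots> = ?G * (1 / ?H - 1) + 1" using pos by (simp add: field_simps)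
  finally show ?thesis by simp
qed

text \<open>At \<open>x = 0\<close> the shift \<open>x - g x\<close> vanishes, so the slope ratios
  of \<open>l\<close> and \<open>h\<close> differ only by the constant
  \<open>right_deriv g 0\<close>.\<close>

lemma assoc_exp_slope_iff: "exp_slope B l \<longleftrightarrow> exp_slope B h"
proof (rule exp_slope_cong)
  show "right_deriv g 0 > 0" using mean by (auto intro: mean_fun_right_deriv)
  have "g 0 = 0" using mean by (simp add: mean_fun_def)
  then show "1 / right_deriv l y - 1 = right_deriv g 0 * (1 / right_deriv h y - 1)" for y
    using assoc_slopes[of y 0] by simp
qed

text \<open>The left side of \<open>assoc_slopes\<close> does not involve \<open>x\<close>.
  Comparing a general \<open>x\<close> with \<open>x = 0\<close> shows that a shift by
  \<open>x - g x\<close> multiplies the slope ratio of \<open>h\<close> by a constant.\<close>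

lemma assoc_exp_slope: "\<exists>B\<ge>0. exp_slope B l"
proof -
  define P where "P y = 1 / right_deriv h y - 1" for y
  have g0: "g 0 = 0" and cg: "concave_on UNIV g" and ch: "concave_on UNIV h"
    using mean by (auto simp: mean_fun_def)
  have dh: "0 < right_deriv h y" "right_deriv h y < 1" and dg: "0 < right_deriv g y" "right_deriv g y < 1"
    for y using mean by (auto intro: mean_fun_right_deriv)
  have "\<exists>A>0. \<exists>B\<ge>0. \<forall>y. P y = A * exp (B * y)"
  proof (rule exponential_of_shifts)
    show "P y > 0" for y using dh[of y] by (simp add: P_def)
    show "mono P"
      using concave_right_deriv_antimono[OF ch] dh by (auto simp: P_def mono_def intro!: divide_left_mono)
    fix s :: real assume s: "s \<ge> 0"
    \<comment> \<open>Concavity and \<open>g 0 = 0\<close> give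
      \<open>g b \<le> right_deriv g 0 * b\<close>, so this \<open>b\<close> satisfies
      \<open>s \<le> b - g b\<close> and the intermediate value theorem applies on
      \<open>{0..b}\<close>.\<close>
    define b where "b = s / (1 - right_deriv g 0)"
    have "0 \<le> b" using s dg[of 0] by (simp add: b_def)
    have "s = (1 - right_deriv g 0) * b" using dg[of 0] by (simp add: b_def)
    also have "\<dots> \<le> b - g b"
      using concave_right_deriv_bounds(1)[OF cg, of 0 b] \<open>0 \<le> b\<close> g0
      by (cases "b = 0") (auto simp: algebra_simps)
    finally have "s \<le> b - g b" .
    moreover have "continuous_on {0..b} (\<lambda>x. x - g x)"
      using continuous_on_minus[OF convex_on_continuous[of UNIV "\<lambda>x. - g x"]] cg
      by (auto intro!: continuous_intros intro: continuous_on_subset simp: concave_on_def)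
    ultimately obtain x where x: "x - g x = s"
      using IVT'[of "\<lambda>x. x - g x" 0 s b] s \<open>0 \<le> b\<close> g0 by auto
    have "right_deriv g x * P (y + s) = right_deriv g 0 * P y" for y
      using assoc_slopes[of y x] assoc_slopes[of y 0] g0 unfolding x P_def by simp
    then have "P (y + s) = P y * (right_deriv g 0 / right_deriv g x)" for y
      using dg(1)[of x] by (simp add: eq_divide_eq mult.commute less_imp_neq[symmetric])
    then show "\<exists>c. \<forall>y. P (y + s) = P y * c" by blast
  qed
  then obtain A B where "A > 0" "B \<ge> 0" "\<And>y. P y = A * exp (B * y)" by blast
  then have "1 / right_deriv h y = 1 + A * exp (B * y)" for y
    unfolding P_def by (simp add: diff_eq_eq add.commute)
  then have "exp_slope B h" using \<open>A > 0\<close> unfolding exp_slope_def by blast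
  then show ?thesis using \<open>B \<ge> 0\<close> assoc_exp_slope_iff by blast
qed

end

subsection \<open>Exponential means\<close>

text \<open>For \<open>B > 0\<close> this is a positive affine transform of \<open>xi (1 / B)\<close>, normalised so that the limit
  \<open>B = 0\<close> is the identity and both cases can be treated together.\<close>

definition phi :: "real \<Rightarrow> real \<Rightarrow> real" where
  "phi B t = (if B = 0 then t else (1 - exp (- (B * t))) / B)"

lemma one_minus_phi: "1 - B * phi B t = exp (- (B * t))"
  by (simp add: phi_def)

lemma phi_0: "phi B 0 = 0"
  by (simp add: phi_def)

lemma has_derivative_phi: "(phi B has_real_derivative exp (- (B * t))) (at t)"
proof (cases "B = 0")
  case True
  then show ?thesis by (simp add: phi_def[abs_def])
next
  case False
  then show ?thesis unfolding phi_def[abs_def] by (auto intro!: derivative_eq_intros)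
qed

lemma strict_mono_phi: "strict_mono (phi B)"
proof (rule strict_monoI)
  fix x y :: real assume "x < y"
  then show "phi B x < phi B y"
    by (rule DERIV_pos_imp_increasing) (use has_derivative_phi in fastforce)
qed

text \<open>Translation acts on \<open>phi B\<close> by a positive affine map, which is why means
  built from it are translation invariant.\<close>

lemma phi_add: "phi B (a + t) = phi B a + exp (- (B * a)) * phi B t"
  by (auto simp: phi_def field_simps simp flip: exp_add)

text \<open>\<open>f y\<close> is the quasi-arithmetic mean of 0 and \<open>y\<close> with weight
  \<open>w\<close> on \<open>y\<close>; the term for 0 vanishes because
  \<open>phi B 0 = 0\<close>.\<close>

definition phi_mean :: "real \<Rightarrow> (real \<Rightarrow> real) \<Rightarrow> bool" where
  "phi_mean B f \<longleftrightarrow> (\<exists>w\<in>{0<..<1}. \<forall>y. phi B (f y) = w * phi B y)"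

text \<open>The prescribed right slope is continuous, so \<open>f\<close> is differentiable and can
  be recovered from a differential equation.\<close>

lemma exp_slope_imp_phi_mean:
  assumes f: "mean_fun f" and "exp_slope B f"
  shows "phi_mean B f"
proof -
  obtain A where A: "A > 0" "\<And>y. 1 / right_deriv f y = 1 + A * exp (B * y)"
    using assms(2) by (auto simp: exp_slope_def)
  have pos: "1 + A * exp (B * y) > 0" "A + exp (- (B * y)) > 0" for y
    using A(1) by (auto intro: add_pos_pos)
  have rd: "right_deriv f y = 1 / (1 + A * exp (B * y))" for y
    using A(2)[of y] by (metis inverse_eq_divide inverse_inverse_eq)
  have "continuous_on UNIV (right_deriv f)"
    unfolding rd[abs_def] using pos by (auto intro!: continuous_intros simp: less_imp_neq[symmetric])
  then have "(f has_real_derivative right_deriv f y) (at y)" for y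
    using f by (intro concave_has_deriv) (auto simp: mean_fun_def continuous_on_eq_continuous_at)
  then have df: "(f has_real_derivative 1 / (1 + A * exp (B * y))) (at y)" for y
    by (simp add: rd)
  \<comment> \<open>Forced by the slopes at 0: \<open>phi B\<close> has slope 1 there, and
    \<open>f\<close> has slope \<open>1 / (1 + A)\<close> with \<open>f 0 = 0\<close>.\<close>
  define w where "w = 1 / (1 + A)"
  \<comment> \<open>\<open>phi B \<circ> f\<close> and \<open>w * phi B\<close> solve the same linear equation \<open>u' = (1 - B u) / (1 + A exp (B y))\<close>,
    whose homogeneous solutions are the multiples of \<open>A + exp (- B y)\<close>.\<close>
  define Z where "Z y = (phi B (f y) - w * phi B y) / (A + exp (- (B * y)))" for y
  have wA: "w * A = 1 - w" using A(1) by (simp add: w_def field_simps)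
  have "(Z has_real_derivative 0) (at y)" for y
  proof -
    define e where "e = exp (- (B * y))"
    have e: "e > 0" "exp (B * y) = 1 / e" by (simp_all add: e_def exp_minus inverse_eq_divide)
    have Ae: "A + e > 0" using A(1) e(1) by simp
    let ?n = "phi B (f y) - w * phi B y"
    have "((\<lambda>y. phi B (f y) - w * phi B y) has_real_derivative
        exp (- (B * f y)) * (1 / (1 + A * exp (B * y))) - w * e) (at y)"
      unfolding e_def
      by (intro DERIV_diff DERIV_cmult has_derivative_phi DERIV_chain2[OF has_derivative_phi df])
    moreover have "((\<lambda>y. A + exp (- (B * y))) has_real_derivative - (B * e)) (at y)"
      unfolding e_def by (auto intro!: derivative_eq_intros)
    ultimately have "(Z has_real_derivative
        ((exp (- (B * f y)) * (1 / (1 + A * exp (B * y))) - w * e) * (A + e) - ?n * (- (B * e)))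
        / ((A + e) * (A + e))) (at y)"
      unfolding Z_def[abs_def] e_def using pos(2)[of y]
      by (intro DERIV_divide) auto
    moreover have "(exp (- (B * f y)) * (1 / (1 + A * exp (B * y))) - w * e) * (A + e)
        - ?n * (- (B * e)) = 0"
    proof -
      have "exp (- (B * f y)) * (1 / (1 + A * exp (B * y))) * (A + e) = (1 - B * phi B (f y)) * e"
        using Ae e(1) by (simp add: e(2) one_minus_phi field_simps)
      moreover have "B * phi B y = 1 - e" using one_minus_phi[of B y] by (simp add: e_def)
      ultimately show ?thesis using wA by algebra
    qed
    ultimately show ?thesis by simp
  qed
  then have "Z y = Z 0" for y by (rule DERIV_isconst_all[rule_format])
  moreover have "Z 0 = 0" using f by (simp add: Z_def mean_fun_def phi_0)
  ultimately have "Z y = 0" for y by simp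
  moreover have "A + exp (- (B * y)) \<noteq> 0" for y using pos(2)[of y] by linarith
  ultimately have "phi B (f y) = w * phi B y" for y by (simp add: Z_def)
  moreover have "w \<in> {0<..<1}" using A(1) by (simp add: w_def)
  ultimately show ?thesis unfolding phi_mean_def by blast
qed

lemma phi_mean_imp_exp_slope:
  assumes f: "mean_fun f" and "phi_mean B f"
  shows "exp_slope B f"
proof -
  obtain w where w: "0 < w" "w < 1" and eq: "\<And>y. phi B (f y) = w * phi B y"
    using assms(2) by (auto simp: phi_mean_def)
  have "1 / right_deriv f y = 1 + (1 - w) / w * exp (B * y)" for y
  proof -
    have "(f has_real_derivative right_deriv f y) (at_right y)"
      using f by (intro concave_has_right_deriv) (simp add: mean_fun_def)
    then have "((\<lambda>y. phi B (f y)) has_real_derivative right_deriv f y * exp (- (B * f y))) (at_right y)"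
      using DERIV_chain'[OF _ has_derivative_phi] by (simp add: mult.commute)
    moreover have "((\<lambda>y. w * phi B y) has_real_derivative w * exp (- (B * y))) (at_right y)"
      by (rule DERIV_cmult[OF has_field_derivative_at_within[OF has_derivative_phi]])
    ultimately have "right_deriv f y * exp (- (B * f y)) = w * exp (- (B * y))"
      unfolding eq by (rule has_field_derivative_unique[OF _ _ trivial_limit_at_right_real])
    moreover have "exp (- (B * f y)) = 1 - w + w * exp (- (B * y))"
      unfolding one_minus_phi[symmetric] eq by (simp add: algebra_simps)
    ultimately have r: "right_deriv f y * (1 - w + w * exp (- (B * y))) = w * exp (- (B * y))"
      by simp
    define e where "e = exp (- (B * y))"
    have e: "e > 0" "exp (B * y) = 1 / e" by (simp_all add: e_def exp_minus inverse_eq_divide)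
    have "right_deriv f y > 0" by (rule mean_fun_right_deriv[OF f])
    moreover have "1 - w + w * e > 0" using w e(1) by (simp add: add_pos_pos)
    ultimately have "right_deriv f y = w * e / (1 - w + w * e)"
      using r by (simp add: eq_divide_eq e_def)
    then have "1 / right_deriv f y = (1 - w + w * e) / (w * e)" by simp
    also have "\<dots> = 1 + (1 - w) / w * exp (B * y)"
      unfolding e(2) using w e(1) by (simp add: field_simps)
    finally show ?thesis .
  qed
  moreover have "(1 - w) / w > 0" using w by simp
  ultimately show ?thesis unfolding exp_slope_def by blast
qed

subsection \<open>Separable translation-invariant preferences\<close>

text \<open>The reduced problem, with \<open>u i\<close> the discounted value under the discount
  factor \<open>i\<close>. Profiles live on the whole type; \<open>mono\<close> makes profiles that
  agree on \<open>D\<close> indifferent. Closedness is required along lines only, so no topology on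
  profiles is needed to find certainty equivalents.\<close>

locale separable_preference =
  fixes D :: "'a set" and P :: "('a \<Rightarrow> real) \<Rightarrow> ('a \<Rightarrow> real) \<Rightarrow> bool"
  assumes fin: "finite D"
    and total: "P u v \<or> P v u"
    and trans: "P u v \<Longrightarrow> P v w \<Longrightarrow> P u w"
    and mono: "(\<And>i. i \<in> D \<Longrightarrow> v i \<le> u i) \<Longrightarrow> P u v"
    and strict: "(\<And>i. i \<in> D \<Longrightarrow> v i \<le> u i) \<Longrightarrow> j \<in> D \<Longrightarrow> v j < u j \<Longrightarrow> \<not> P v u"
    and closed_above: "closed {t. P (\<lambda>i. u i + t * v i) w}"
    and closed_below: "closed {t. P w (\<lambda>i. u i + t * v i)}"
    and convex: "P u v \<Longrightarrow> P v u \<Longrightarrow> \<alpha> \<in> {0..1} \<Longrightarrow> P (\<lambda>i. \<alpha> * u i + (1 - \<alpha>) * v i) u"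
    and shift: "P (\<lambda>i. u i + c) (\<lambda>i. v i + c) \<longleftrightarrow> P u v"
    and separable: "E \<subseteq> D \<Longrightarrow> (\<And>i. i \<in> E \<Longrightarrow> u i = u' i \<and> v i = v' i) \<Longrightarrow>
      (\<And>i. i \<in> D - E \<Longrightarrow> u i = v i \<and> u' i = v' i) \<Longrightarrow> P u v \<longleftrightarrow> P u' v'"
begin

abbreviation fill :: "'a set \<Rightarrow> real \<Rightarrow> ('a \<Rightarrow> real) \<Rightarrow> 'a \<Rightarrow> real" where
  "fill E c u \<equiv> \<lambda>i. if i \<in> E then c else u i"

text \<open>The certainty equivalent conditional on \<open>E\<close>; by separability it ignores the profile outside
  \<open>E\<close>.\<close>

definition ce :: "'a set \<Rightarrow> ('a \<Rightarrow> real) \<Rightarrow> real" where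
  "ce E u = (THE c. P u (fill E c u) \<and> P (fill E c u) u)"

definition coalition :: "'a set \<Rightarrow> bool" where
  "coalition E \<longleftrightarrow> E \<subseteq> D \<and> E \<noteq> {}"

section \<open>Certainty equivalents of coalitions\<close>

lemma fill_le_iff:
  assumes "coalition E"
  shows "P (fill E c u) (fill E c' u) \<longleftrightarrow> c' \<le> c"
proof (cases "c' \<le> c")
  case True
  then show ?thesis by (auto intro: mono)
next
  case False
  obtain j where "j \<in> E" "j \<in> D" using assms by (auto simp: coalition_def)
  then have "\<not> P (fill E c u) (fill E c' u)"
    using False by (intro strict[of _ _ j]) auto
  then show ?thesis using False by simp
qed

text \<open>The levels weakly better than \<open>u\<close> and those weakly worse are closed and
  cover the line. The maximum and the minimum of \<open>u\<close> on \<open>E\<close> show that both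
  sets are nonempty, so by connectedness they meet.\<close>

lemma fill_indifferent_exists:
  assumes "coalition E"
  shows "\<exists>c. P u (fill E c u) \<and> P (fill E c u) u"
proof -
  have E: "finite E" "E \<noteq> {}" using assms fin by (auto simp: coalition_def finite_subset)
  define p where "p t = fill E t u" for t
  define u0 where "u0 = fill E 0 u"
  have path: "p t = (\<lambda>i. u0 i + t * indicator E i)" for t
    by (rule ext) (simp add: p_def u0_def)
  have "closed {t. P (p t) u}" "closed {t. P u (p t)}"
    unfolding path by (rule closed_above closed_below)+
  moreover have "UNIV \<subseteq> {t. P (p t) u} \<union> {t. P u (p t)}" using total by blast
  moreover have "P (p (Max (u ` E))) u"
    by (rule mono) (simp add: p_def E(1))
  moreover have "P u (p (Min (u ` E)))"
    by (rule mono) (simp add: p_def E(1))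
  ultimately have "{t. P (p t) u} \<inter> {t. P u (p t)} \<noteq> {}"
    using connected_closedD[OF connected_UNIV, of "{t. P (p t) u}" "{t. P u (p t)}"] by auto
  then show ?thesis unfolding p_def by blast
qed

lemma ce_indifferent:
  assumes "coalition E"
  shows "P u (fill E (ce E u) u)" "P (fill E (ce E u) u) u"
proof -
  have "\<exists>!c. P u (fill E c u) \<and> P (fill E c u) u"
  proof (rule ex_ex1I[OF fill_indifferent_exists[OF assms]])
    fix c d
    assume "P u (fill E c u) \<and> P (fill E c u) u" "P u (fill E d u) \<and> P (fill E d u) u"
    then show "c = d"
      using fill_le_iff[OF assms, where u=u] trans by (meson order_antisym)
  qed
  from theI'[OF this] show "P u (fill E (ce E u) u)" "P (fill E (ce E u) u) u"
    unfolding ce_def by blast+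
qed

lemma le_ce_iff: "coalition E \<Longrightarrow> c \<le> ce E u \<longleftrightarrow> P u (fill E c u)"
  using ce_indifferent[of E u] fill_le_iff[of E] trans by blast

lemma ce_le_iff: "coalition E \<Longrightarrow> ce E u \<le> c \<longleftrightarrow> P (fill E c u) u"
  using ce_indifferent[of E u] fill_le_iff[of E] trans by blast

lemma ce_eqI: "coalition E \<Longrightarrow> P u (fill E c u) \<Longrightarrow> P (fill E c u) u \<Longrightarrow> ce E u = c"
  using le_ce_iff ce_le_iff by (simp add: order_antisym)

lemma ce_cong:
  assumes "coalition E" "\<And>i. i \<in> E \<Longrightarrow> u i = v i"
  shows "ce E u = ce E v"
proof (rule ce_eqI[OF assms(1)])
  have "P u (fill E (ce E v) u) \<longleftrightarrow> P v (fill E (ce E v) v)"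
    "P (fill E (ce E v) u) u \<longleftrightarrow> P (fill E (ce E v) v) v"
    by (rule separable[of E]; use assms in \<open>simp add: coalition_def\<close>)+
  then show "P u (fill E (ce E v) u)" "P (fill E (ce E v) u) u"
    using ce_indifferent[OF assms(1)] by auto
qed

lemma ce_strict_mono:
  assumes E: "coalition E" and le: "\<And>i. i \<in> E \<Longrightarrow> u i \<le> v i" and j: "j \<in> E" "u j < v j"
  shows "ce E u < ce E v"
proof (rule ccontr)
  \<comment> \<open>\<open>v\<close> may be lower than \<open>u\<close> outside \<open>E\<close>;
    this modification agrees with \<open>u\<close> there, so \<open>strict\<close> applies, and
    \<open>ce E\<close> cannot tell it from \<open>v\<close>.\<close>
  let ?v = "\<lambda>i. if i \<in> E then v i else u i"
  assume "\<not> ?thesis"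
  moreover have "ce E ?v = ce E v" by (rule ce_cong[OF E]) simp
  ultimately have "P (fill E (ce E u) ?v) ?v" by (simp only: ce_le_iff[OF E, symmetric])
  moreover have "fill E (ce E u) u = fill E (ce E u) ?v" by auto
  ultimately have "P u ?v" using ce_indifferent(1)[OF E] trans by metis
  moreover have "\<not> P u ?v" using le j E by (intro strict[of _ _ j]) (auto simp: coalition_def)
  ultimately show False by blast
qed

lemma ce_shift:
  assumes "coalition E"
  shows "ce E (\<lambda>i. u i + t) = ce E u + t"
proof (rule ce_eqI[OF assms])
  have "fill E (ce E u + t) (\<lambda>i. u i + t) = (\<lambda>i. fill E (ce E u) u i + t)" by auto
  then show "P (\<lambda>i. u i + t) (fill E (ce E u + t) (\<lambda>i. u i + t))"
    "P (fill E (ce E u + t) (\<lambda>i. u i + t)) (\<lambda>i. u i + t)"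
    using ce_indifferent[OF assms, of u] by (simp_all only: shift)
qed

lemma ce_const: "coalition E \<Longrightarrow> ce E (\<lambda>_. c) = c"
  by (rule ce_eqI) (auto intro: mono)

text \<open>Translation invariance upgrades quasiconcavity to concavity.\<close>

lemma ce_concave:
  assumes E: "coalition E" and \<alpha>: "\<alpha> \<in> {0..1}"
  shows "\<alpha> * ce E u + (1 - \<alpha>) * ce E v \<le> ce E (\<lambda>i. \<alpha> * u i + (1 - \<alpha>) * v i)"
proof -
  \<comment> \<open>Subtracting its own certainty equivalent makes every profile indifferent to the
    constant 0, hence any two of them indifferent to each other, as \<open>convex\<close>
    requires.\<close>
  define centred where "centred u = (\<lambda>i. if i \<in> E then u i - ce E u else 0)" for u
  have eq: "ce E (centred u) = 0" for u
  proof -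
    have "ce E (centred u) = ce E (\<lambda>i. u i + - ce E u)" by (rule ce_cong[OF E]) (simp add: centred_def)
    then show ?thesis by (simp only: ce_shift[OF E])
  qed
  have fill: "fill E 0 (centred u) = (\<lambda>_. 0)" for u by (auto simp: centred_def)
  have centred: "P (centred u) (\<lambda>_. 0)" "P (\<lambda>_. 0) (centred u)" for u
    using ce_indifferent[OF E, of "centred u"] unfolding eq fill by blast+
  let ?m = "\<lambda>i. \<alpha> * centred u i + (1 - \<alpha>) * centred v i"
  have "P (centred u) (centred v)" "P (centred v) (centred u)" by (rule trans[OF centred(1) centred(2)])+
  then have "P ?m (\<lambda>_. 0)" by (rule trans[OF convex[OF _ _ \<alpha>] centred(1)])
  moreover have "fill E 0 ?m = (\<lambda>_. 0)" by (auto simp: centred_def)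
  ultimately have "0 \<le> ce E ?m" by (simp add: le_ce_iff[OF E])
  also have "ce E ?m = ce E (\<lambda>i. \<alpha> * u i + (1 - \<alpha>) * v i + - (\<alpha> * ce E u + (1 - \<alpha>) * ce E v))"
    by (rule ce_cong[OF E]) (simp add: centred_def algebra_simps)
  finally show ?thesis by (simp only: ce_shift[OF E])
qed

text \<open>Replacing \<open>u\<close> on \<open>E\<close> by its certainty equivalent is an
  indifferent move, so transitivity preserves the value of any larger group. This permits evaluation
  in stages.\<close>

lemma ce_nested:
  assumes "coalition E" "coalition F" "E \<subseteq> F"
  shows "ce F (fill E (ce E u) u) = ce F u"
proof (rule sym, rule ce_eqI[OF assms(2)])
  let ?u = "fill E (ce E u) u"
  have "fill F (ce F ?u) ?u = fill F (ce F ?u) u"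
    by (rule ext) (use assms(3) in auto)
  note F = ce_indifferent[OF assms(2), of ?u, unfolded this]
  show "P u (fill F (ce F ?u) u)" "P (fill F (ce F ?u) u) u"
    by (rule trans[OF ce_indifferent(1)[OF assms(1)] F(1)]
        trans[OF F(2) ce_indifferent(2)[OF assms(1)]])+
qed

lemma P_iff_ce:
  assumes "D \<noteq> {}"
  shows "P u v \<longleftrightarrow> ce D v \<le> ce D u"
proof -
  have D: "coalition D" using assms by (simp add: coalition_def)
  \<comment> \<open>With \<open>E = D\<close> in \<open>separable\<close> the condition on the
    complement is vacuous, so the values outside \<open>D\<close> may be exchanged.\<close>
  have "P (fill D a u) (fill D b v) \<longleftrightarrow> P (fill D a u) (fill D b u)" for a b
    by (rule separable[of D]) auto
  then have "P (fill D a u) (fill D b v) \<longleftrightarrow> b \<le> a" for a b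
    by (simp add: fill_le_iff[OF D])
  then show ?thesis
    using ce_indifferent[OF D, of u] ce_indifferent[OF D, of v] trans by blast
qed

section \<open>Merging two disjoint coalitions\<close>

definition agg :: "'a set \<Rightarrow> 'a set \<Rightarrow> real \<Rightarrow> real" where
  "agg E F y = ce (E \<union> F) (fill E 0 (\<lambda>_. y))"

definition disjoint_coalitions :: "'a set \<Rightarrow> 'a set \<Rightarrow> bool" where
  "disjoint_coalitions E F \<longleftrightarrow> coalition E \<and> coalition F \<and> E \<inter> F = {}"

lemma coalition_Un: "coalition E \<Longrightarrow> coalition F \<Longrightarrow> coalition (E \<union> F)"
  by (auto simp: coalition_def)

text \<open>Translation by \<open>-b\<close> moves the level of \<open>E\<close> to 0, so a function
  of the single difference \<open>c - b\<close> describes the merger.\<close>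

lemma ce_pair:
  assumes "disjoint_coalitions E F" "\<And>i. i \<in> E \<Longrightarrow> u i = b" "\<And>i. i \<in> F \<Longrightarrow> u i = c"
  shows "ce (E \<union> F) u = b + agg E F (c - b)"
proof -
  have s: "coalition (E \<union> F)" using assms(1) by (auto simp: disjoint_coalitions_def intro: coalition_Un)
  have "ce (E \<union> F) u = ce (E \<union> F) (\<lambda>i. fill E 0 (\<lambda>_. c - b) i + b)"
    by (rule ce_cong[OF s]) (use assms in \<open>auto simp: disjoint_coalitions_def\<close>)
  then show ?thesis by (simp only: ce_shift[OF s] agg_def)
qed

text \<open>Levels \<open>y\<close> on \<open>E\<close> and 0 on \<open>F\<close> are renormalised
  by translating by \<open>-y\<close>. The reflection turns monotonicity of \<open>agg F E\<close>
  into that of \<open>y - agg E F y\<close>.\<close>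

lemma agg_swap:
  assumes "disjoint_coalitions E F"
  shows "agg F E y = y + agg E F (- y)"
proof -
  have "agg F E y = ce (E \<union> F) (fill F 0 (\<lambda>_. y))" by (simp add: agg_def Un_commute)
  also have "\<dots> = y + agg E F (0 - y)"
    by (rule ce_pair[OF assms]) (use assms in \<open>auto simp: disjoint_coalitions_def\<close>)
  finally show ?thesis by simp
qed

lemma agg_strict_mono:
  assumes "disjoint_coalitions E F"
  shows "strict_mono (agg E F)"
proof (rule strict_monoI)
  fix x y :: real assume "x < y"
  obtain j where "j \<in> F" "j \<notin> E" using assms by (auto simp: disjoint_coalitions_def coalition_def)
  then show "agg E F x < agg E F y"
    unfolding agg_def using \<open>x < y\<close> assms
    by (intro ce_strict_mono[where j=j]) (auto simp: disjoint_coalitions_def intro: coalition_Un)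
qed

lemma disjoint_coalitions_sym: "disjoint_coalitions E F \<Longrightarrow> disjoint_coalitions F E"
  by (auto simp: disjoint_coalitions_def)

lemma mean_fun_agg:
  assumes d: "disjoint_coalitions E F"
  shows "mean_fun (agg E F)"
  unfolding mean_fun_def
proof (intro conjI)
  have s: "coalition (E \<union> F)" using d by (auto simp: disjoint_coalitions_def intro: coalition_Un)
  show "strict_mono (agg E F)" by (rule agg_strict_mono[OF d])
  show "strict_mono (\<lambda>y. y - agg E F y)"
  proof (rule strict_monoI)
    fix x y :: real assume "x < y"
    then have "agg F E (- y) < agg F E (- x)"
      using agg_strict_mono[OF disjoint_coalitions_sym[OF d]] by (simp add: strict_mono_less)
    then show "x - agg E F x < y - agg E F y"
      using agg_swap[OF disjoint_coalitions_sym[OF d]] by simp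
  qed
  show "agg E F 0 = 0" unfolding agg_def using ce_const[OF s, of 0] by simp
  show "concave_on UNIV (agg E F)"
    unfolding concave_on_iff
  proof (intro conjI ballI allI impI)
    fix x y u v :: real assume uv: "0 \<le> u" "0 \<le> v" "u + v = 1"
    then have v: "v = 1 - u" by simp
    let ?f = "\<lambda>y. fill E 0 (\<lambda>_. y)"
    have "u * ce (E \<union> F) (?f x) + (1 - u) * ce (E \<union> F) (?f y)
        \<le> ce (E \<union> F) (\<lambda>i. u * ?f x i + (1 - u) * ?f y i)"
      by (rule ce_concave[OF s]) (use uv in auto)
    also have "(\<lambda>i. u * ?f x i + (1 - u) * ?f y i) = ?f (u * x + (1 - u) * y)" by auto
    finally show "u * agg E F x + v * agg E F y \<le> agg E F (u *\<^sub>R x + v *\<^sub>R y)"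
      by (simp add: agg_def v)
  qed simp
qed

text \<open>Levels 0, \<open>x\<close>, \<open>x + y\<close> on \<open>E\<close>, \<open>F\<close>,
  \<open>G\<close> are evaluated by merging \<open>E\<close> with \<open>F\<close> first, or
  \<open>F\<close> with \<open>G\<close> first. The third level is \<open>x + y\<close> so that the
  gap inside the second inner merger is \<open>y\<close>.\<close>

lemma agg_assoc:
  assumes d: "disjoint_coalitions E F" "disjoint_coalitions E G" "disjoint_coalitions F G"
  shows "agg E F x + agg (E \<union> F) G (x + y - agg E F x) = agg E (F \<union> G) (x + agg F G y)"
proof -
  have s: "coalition (E \<union> F)" "coalition (F \<union> G)" "coalition (E \<union> F \<union> G)"
    and d': "disjoint_coalitions (E \<union> F) G" "disjoint_coalitions E (F \<union> G)"
    using d by (auto simp: disjoint_coalitions_def coalition_Un)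
  define u where "u i = (if i \<in> E then 0 else if i \<in> F then x else x + y)" for i
  have EF: "ce (E \<union> F) u = agg E F x"
  proof -
    have "ce (E \<union> F) u = 0 + agg E F (x - 0)"
      by (rule ce_pair[OF d(1)]) (use d in \<open>auto simp: u_def disjoint_coalitions_def\<close>)
    then show ?thesis by simp
  qed
  have "ce (E \<union> F \<union> G) u = ce (E \<union> F \<union> G) (fill (E \<union> F) (agg E F x) u)"
    using ce_nested[OF s(1) s(3), of u, unfolded EF] by auto
  also have "\<dots> = agg E F x + agg (E \<union> F) G (x + y - agg E F x)"
    by (rule ce_pair[OF d'(1)]) (use d in \<open>auto simp: u_def disjoint_coalitions_def\<close>)
  finally have 1: "ce (E \<union> F \<union> G) u = agg E F x + agg (E \<union> F) G (x + y - agg E F x)" .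
  have FG: "ce (F \<union> G) u = x + agg F G y"
  proof -
    have "ce (F \<union> G) u = x + agg F G (x + y - x)"
      by (rule ce_pair[OF d(3)]) (use d in \<open>auto simp: u_def disjoint_coalitions_def\<close>)
    then show ?thesis by simp
  qed
  have "ce (E \<union> F \<union> G) u = ce (E \<union> F \<union> G) (fill (F \<union> G) (x + agg F G y) u)"
    by (rule sym, rule ce_nested[OF s(2) s(3), of u, unfolded FG]) auto
  also have "\<dots> = ce (E \<union> (F \<union> G)) (fill (F \<union> G) (x + agg F G y) u)" by (simp add: Un_assoc)
  also have "\<dots> = 0 + agg E (F \<union> G) (x + agg F G y - 0)"
    by (rule ce_pair[OF d'(2)]) (use d in \<open>auto simp: u_def disjoint_coalitions_def\<close>)
  finally show ?thesis using 1 by simp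
qed

text \<open>Slopes alone do not suffice: the reflection in \<open>agg_swap\<close> would turn right
  derivatives into left ones. In the form \<open>phi_mean\<close> the exchange just replaces
  \<open>w\<close> by \<open>1 - w\<close>.\<close>

lemma exp_slope_agg_swap:
  assumes d: "disjoint_coalitions E F" and "exp_slope B (agg E F)"
  shows "exp_slope B (agg F E)"
proof (rule phi_mean_imp_exp_slope[OF mean_fun_agg[OF disjoint_coalitions_sym[OF d]]])
  have "phi_mean B (agg E F)"
    by (rule exp_slope_imp_phi_mean[OF mean_fun_agg[OF d] assms(2)])
  then obtain w where w: "0 < w" "w < 1" "\<And>y. phi B (agg E F y) = w * phi B y"
    by (auto simp: phi_mean_def)
  have "phi B (agg F E y) = (1 - w) * phi B y" for y
  proof -
    have "phi B (agg F E y) = phi B y + w * (exp (- (B * y)) * phi B (- y))"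
      by (simp add: agg_swap[OF d] phi_add w)
    moreover have "phi B y + exp (- (B * y)) * phi B (- y) = 0"
      using phi_add[of B y "- y"] by (simp add: phi_0)
    ultimately show ?thesis by algebra
  qed
  moreover have "1 - w \<in> {0<..<1}" using w by simp
  ultimately show "phi_mean B (agg F E)" unfolding phi_mean_def by blast
qed

lemma exp_slope_agg_Un_iff:
  assumes "disjoint_coalitions E F" "disjoint_coalitions E G" "disjoint_coalitions F G"
  shows "exp_slope B (agg F G) \<longleftrightarrow> exp_slope B (agg (E \<union> F) G)"
  by (rule assoc_exp_slope_iff[where g = "agg E F" and k = "agg E (F \<union> G)"])
    (use assms in \<open>auto intro!: mean_fun_agg agg_assoc simp: disjoint_coalitions_def coalition_Un\<close>)

lemma exp_slope_agg_exists:
  assumes "disjoint_coalitions E F" "disjoint_coalitions E G" "disjoint_coalitions F G"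
  shows "\<exists>B\<ge>0. exp_slope B (agg F G)"
  by (rule assoc_exp_slope[where g = "agg E F" and k = "agg E (F \<union> G)" and h = "agg (E \<union> F) G"])
    (use assms in \<open>auto intro!: mean_fun_agg agg_assoc simp: disjoint_coalitions_def coalition_Un\<close>)

lemma exp_slope_agg_subset_iff:
  assumes "disjoint_coalitions F G" "coalition E" "E \<subseteq> F"
  shows "exp_slope B (agg E G) \<longleftrightarrow> exp_slope B (agg F G)"
proof (cases "E = F")
  case False
  then have "disjoint_coalitions (F - E) E" "disjoint_coalitions (F - E) G" "disjoint_coalitions E G"
    using assms by (auto simp: disjoint_coalitions_def coalition_def)
  from exp_slope_agg_Un_iff[OF this] show ?thesis using assms(3) by (simp add: Un_absorb2)
qed simp

text \<open>Singletons on the right are enough for the later induction, which adds one member at a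
  time.\<close>

lemma exp_slope_agg_common:
  assumes "card D \<ge> 3"
  shows "\<exists>B\<ge>0. \<forall>E m. coalition E \<longrightarrow> m \<in> D \<longrightarrow> m \<notin> E \<longrightarrow> exp_slope B (agg E {m})"
proof -
  obtain i j k where ijk: "i \<in> D" "j \<in> D" "k \<in> D" "i \<noteq> j" "i \<noteq> k" "j \<noteq> k"
  proof -
    obtain T where "T \<subseteq> D" "card T = 3" using obtain_subset_with_card_n[OF assms] by metis
    then show ?thesis using that unfolding card_3_iff by blast
  qed
  then have d3: "disjoint_coalitions {i} {j}" "disjoint_coalitions {i} {k}" "disjoint_coalitions {j} {k}" by (auto simp: disjoint_coalitions_def coalition_def)
  from exp_slope_agg_exists[OF this] obtain B where "B \<ge> 0" and B: "exp_slope B (agg {j} {k})"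
    by blast
  have others: "exp_slope B (agg E {m})"
    if "exp_slope B (agg {l} {m})" "l \<in> D" "m \<in> D" "l \<noteq> m" "coalition E" "m \<notin> E" for E l m
  proof -
    \<comment> \<open>\<open>D - {m}\<close> is the largest group avoiding \<open>m\<close> and
      serves as a hub: it contains both \<open>{l}\<close> and \<open>E\<close>, so their mergers
      with \<open>{m}\<close> share its exponent.\<close>
    have d: "disjoint_coalitions (D - {m}) {m}" "coalition {l}" "{l} \<subseteq> D - {m}" "E \<subseteq> D - {m}"
      using that by (auto simp: disjoint_coalitions_def coalition_def)
    show ?thesis
      using that(1) exp_slope_agg_subset_iff[OF d(1-3)] exp_slope_agg_subset_iff[OF d(1) that(5) d(4)]
      by simp
  qed
  have "exp_slope B (agg E {m})" if E: "coalition E" "m \<in> D" "m \<notin> E" for E m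
  proof (cases "m = k")
    case True
    then show ?thesis using others[OF B] ijk E by auto
  next
    case False
    \<comment> \<open>The right-hand member changes from \<open>k\<close> to \<open>m\<close>
      through the pair \<open>{m}\<close>, \<open>{k}\<close>, read in both orders.\<close>
    have "exp_slope B (agg {m} {k})"
      using others[OF B] ijk False E by (auto simp: coalition_def)
    then have "exp_slope B (agg {k} {m})"
      by (rule exp_slope_agg_swap[rotated]) (use E ijk False in \<open>auto simp: disjoint_coalitions_def coalition_def\<close>)
    then show ?thesis using others ijk False E by blast
  qed
  then show ?thesis using \<open>B \<ge> 0\<close> by blast
qed

text \<open>Members are added one by one: the old group is replaced by its certainty equivalent, the
  newcomer receives weight \<open>w\<close>, and the old weights are scaled by \<open>1 - w\<close>.
  \<open>phi_add\<close> turns the level difference in \<open>ce_pair\<close> into a difference of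
  \<open>phi B\<close> values.\<close>

lemma phi_ce_representation:
  assumes B: "\<And>E m. coalition E \<Longrightarrow> m \<in> D \<Longrightarrow> m \<notin> E \<Longrightarrow> phi_mean B (agg E {m})"
    and "coalition E"
  shows "\<exists>p. (\<forall>i\<in>E. p i > 0) \<and> sum p E = 1 \<and> (\<forall>u. phi B (ce E u) = (\<Sum>i\<in>E. p i * phi B (u i)))"
proof -
  have "finite E" "E \<noteq> {}" "E \<subseteq> D" using assms(2) fin by (auto simp: coalition_def finite_subset)
  then show ?thesis
  proof (induction E rule: finite_ne_induct)
    case (singleton m)
    then have "coalition {m}" by (simp add: coalition_def)
    then have "ce {m} u = u m" for u using ce_cong[of "{m}" u "\<lambda>_. u m"] ce_const by simp
    then show ?case by (intro exI[of _ "\<lambda>_. 1"]) simp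
  next
    case (insert m E)
    then obtain p where p: "\<And>i. i \<in> E \<Longrightarrow> p i > 0" "sum p E = 1"
      "\<And>u. phi B (ce E u) = (\<Sum>i\<in>E. p i * phi B (u i))" by auto
    have s: "coalition E" "coalition (insert m E)" "disjoint_coalitions E {m}" using insert by (auto simp: coalition_def disjoint_coalitions_def)
    have "phi_mean B (agg E {m})" using B insert s by simp
    then obtain w where w: "w \<in> {0<..<1}" "\<And>y. phi B (agg E {m} y) = w * phi B y"
      unfolding phi_mean_def by blast
    define q where "q i = (if i = m then w else (1 - w) * p i)" for i
    have q: "(\<Sum>i\<in>E. q i * f i) = (1 - w) * (\<Sum>i\<in>E. p i * f i)" for f :: "'a \<Rightarrow> real"
    proof -
      have "q i = (1 - w) * p i" if "i \<in> E" for i using that insert.hyps by (auto simp: q_def)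
      then show ?thesis unfolding sum_distrib_left by (intro sum.cong) simp_all
    qed
    have "\<forall>i\<in>insert m E. q i > 0" using w p(1) by (auto simp: q_def)
    moreover have "sum q (insert m E) = 1"
      using insert.hyps q[of "\<lambda>_. 1"] p(2) by (simp add: q_def)
    moreover have "phi B (ce (insert m E) u) = (\<Sum>i\<in>insert m E. q i * phi B (u i))" for u
    proof -
      let ?c = "ce E u"
      have "ce (insert m E) u = ce (E \<union> {m}) (fill E ?c u)"
        using ce_nested[OF s(1,2), of u] by (simp add: insert_commute subset_insertI)
      also have "\<dots> = ?c + agg E {m} (u m - ?c)"
        by (rule ce_pair[OF s(3)]) (use insert.hyps in auto)
      finally have "phi B (ce (insert m E) u) = phi B ?c + w * (exp (- (B * ?c)) * phi B (u m - ?c))"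
        by (simp add: phi_add w(2))
      also have "exp (- (B * ?c)) * phi B (u m - ?c) = phi B (u m) - phi B ?c"
        using phi_add[of B ?c "u m - ?c"] by simp
      finally show ?thesis
        using insert.hyps q[of "\<lambda>i. phi B (u i)"] p(3)[of u] by (simp add: q_def algebra_simps)
    qed
    ultimately show ?case by blast
  qed
qed

lemma phi_representation:
  assumes "card D \<ge> 3"
  shows "\<exists>B\<ge>0. \<exists>p. (\<forall>i\<in>D. p i > 0) \<and> sum p D = 1 \<and>
    (\<forall>u v. P u v \<longleftrightarrow> (\<Sum>i\<in>D. p i * phi B (v i)) \<le> (\<Sum>i\<in>D. p i * phi B (u i)))"
proof -
  obtain B where "B \<ge> 0" and B: "\<And>E m. coalition E \<Longrightarrow> m \<in> D \<Longrightarrow> m \<notin> E \<Longrightarrow> exp_slope B (agg E {m})"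
    using exp_slope_agg_common[OF assms] by blast
  have D: "D \<noteq> {}" "coalition D" using assms by (auto simp: coalition_def)
  have "phi_mean B (agg E {m})" if "coalition E" "m \<in> D" "m \<notin> E" for E m
    by (rule exp_slope_imp_phi_mean[OF mean_fun_agg B]) (use that in \<open>auto simp: disjoint_coalitions_def coalition_def\<close>)
  from phi_ce_representation[OF this D(2)] obtain p
    where p: "\<forall>i\<in>D. p i > 0" "sum p D = 1" "\<And>u. phi B (ce D u) = (\<Sum>i\<in>D. p i * phi B (u i))"
    by blast
  have "P u v \<longleftrightarrow> phi B (ce D v) \<le> phi B (ce D u)" for u v
    by (simp add: P_iff_ce[OF D(1)] strict_mono_less_eq[OF strict_mono_phi])
  then have "\<forall>u v. P u v \<longleftrightarrow> (\<Sum>i\<in>D. p i * phi B (v i)) \<le> (\<Sum>i\<in>D. p i * phi B (u i))"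
    by (simp add: p(3))
  then show ?thesis using p \<open>B \<ge> 0\<close> by blast
qed

end

subsection \<open>Bounded sequences and discounting\<close>

text \<open>Discounting such a sequence evaluates the polynomial at the discount factor, so
  prescribing discounted values on \<open>D\<close> becomes an interpolation problem.\<close>

definition seq_of_poly :: "real poly \<Rightarrow> linf" where
  "seq_of_poly p = Bcontfun (coeff p)"

lemma apply_seq_of_poly: "apply_bcontfun (seq_of_poly p) = coeff p"
proof -
  have "coeff p t \<in> insert 0 (coeff p ` {..degree p})" for t
    by (cases "t \<le> degree p") (auto simp: coeff_eq_0)
  then have "coeff p ` UNIV \<subseteq> insert 0 (coeff p ` {..degree p})" by (rule image_subsetI)
  then have "bounded (range (coeff p))"
    by (rule bounded_subset[rotated]) (auto intro: finite_imp_bounded)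
  then show ?thesis unfolding seq_of_poly_def by (simp add: Bcontfun_inverse bcontfun_def)
qed

lemma discounted_seq_of_poly: "discounted \<delta> (seq_of_poly p) = poly p \<delta>"
proof -
  have "discounted \<delta> (seq_of_poly p) = (\<Sum>t\<le>degree p. \<delta> ^ t * coeff p t)"
    unfolding discounted_def apply_seq_of_poly by (rule suminf_finite) (auto simp: coeff_eq_0)
  then show ?thesis by (simp add: poly_altdef mult.commute)
qed

lemma bounded_linear_discounted:
  assumes "\<delta> \<in> {0<..<1}"
  shows "bounded_linear (discounted \<delta>)"
proof (rule bounded_linear_intro)
  note s = summable_discounted[OF assms]
  show "discounted \<delta> (x + y) = discounted \<delta> x + discounted \<delta> y" for x y
    unfolding discounted_def suminf_add[OF s s] by (simp add: algebra_simps)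
  show "discounted \<delta> (r *\<^sub>R x) = r *\<^sub>R discounted \<delta> x" for r x
    using suminf_mult[OF s, of r x] by (simp add: discounted_def algebra_simps)
  have g: "(\<lambda>t. \<delta> ^ t * c) sums (1 / (1 - \<delta>) * c)" for c
    using assms by (intro sums_mult2 geometric_sums) auto
  show "norm (discounted \<delta> x) \<le> norm x * (1 / (1 - \<delta>))" for x
  proof -
    have "norm (discounted \<delta> x) \<le> (\<Sum>t. \<delta> ^ t * norm x)"
      unfolding discounted_def
    proof (rule norm_suminf_le)
      show "norm (\<delta> ^ t * apply_bcontfun x t) \<le> \<delta> ^ t * norm x" for t
        using assms norm_bounded[of x t] by (auto simp: abs_mult intro!: mult_left_mono)
      show "summable (\<lambda>t. \<delta> ^ t * norm x)" using g sums_summable by blast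
    qed
    also have "\<dots> = norm x * (1 / (1 - \<delta>))" 
      using sums_unique[OF g[of "norm x"], symmetric] by (simp only: mult.commute)
    finally show ?thesis .
  qed
qed

lemma discounted_linear:
  assumes "\<delta> \<in> {0<..<1}"
  shows "discounted \<delta> (x + y) = discounted \<delta> x + discounted \<delta> y"
    and "discounted \<delta> (r *\<^sub>R x) = r * discounted \<delta> x"
proof -
  interpret bounded_linear "discounted \<delta>" by (rule bounded_linear_discounted[OF assms])
  show "discounted \<delta> (x + y) = discounted \<delta> x + discounted \<delta> y" by (rule add)
  show "discounted \<delta> (r *\<^sub>R x) = r * discounted \<delta> x" by (simp add: scaleR)
qed

lemma lagrange_basis_exists:
  fixes D :: "'a::field set"
  assumes "finite D"
  shows "\<exists>p. \<forall>a\<in>D. poly p a = (if a = b then 1 else 0)"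
proof -
  let ?q = "\<Prod>a\<in>D - {b}. [:- a, 1:]"
  have "poly ?q b \<noteq> 0" using assms by (auto simp: poly_prod)
  moreover have "poly ?q a = 0" if "a \<in> D" "a \<noteq> b" for a
    using assms that by (auto simp: poly_prod)
  ultimately show ?thesis by (intro exI[of _ "smult (1 / poly ?q b) ?q"]) auto
qed

text \<open>Linearity of \<open>X\<close> maps lines of profiles to lines of sequences, so that
  continuity in the supremum norm yields closedness along lines.\<close>

lemma linear_interpolation_exists:
  assumes "finite D" "D \<subseteq> {0<..<1}"
  obtains X :: "(real \<Rightarrow> real) \<Rightarrow> linf" where
    "\<And>u \<delta>. \<delta> \<in> D \<Longrightarrow> discounted \<delta> (X u) = u \<delta>"
    "\<And>u v t. X (\<lambda>\<delta>. u \<delta> + t * v \<delta>) = X u + t *\<^sub>R X v"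
proof -
  from lagrange_basis_exists[OF assms(1)]
  obtain q where q: "\<And>a b. a \<in> D \<Longrightarrow> poly (q b) a = (if a = b then 1 else 0)" by metis
  define X where "X u = (\<Sum>b\<in>D. u b *\<^sub>R seq_of_poly (q b))" for u :: "real \<Rightarrow> real"
  show thesis
  proof
    fix u \<delta> assume \<delta>: "\<delta> \<in> D"
    then interpret bounded_linear "discounted \<delta>"
      using assms(2) by (intro bounded_linear_discounted) auto
    have "discounted \<delta> (X u) = (\<Sum>b\<in>D. u b * (if \<delta> = b then 1 else 0))"
      using \<delta> by (simp add: X_def sum scaleR discounted_seq_of_poly q)
    also have "\<dots> = (\<Sum>b\<in>D. if \<delta> = b then u b else 0)" by (rule sum.cong) auto
    finally show "discounted \<delta> (X u) = u \<delta>" using \<delta> assms(1) by simp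
  next
    show "X (\<lambda>\<delta>. u \<delta> + t * v \<delta>) = X u + t *\<^sub>R X v" for u v t
      by (simp add: X_def scaleR_add_left sum.distrib scaleR_sum_right)
  qed
qed

lemma full_support_measure_exists:
  assumes "finite D" "\<And>\<delta>. \<delta> \<in> D \<Longrightarrow> p \<delta> > 0" "sum p D = 1"
  obtains \<nu> where "\<nu> \<in> full_support_measures D" "\<And>\<delta>. \<delta> \<in> D \<Longrightarrow> pmf \<nu> \<delta> = p \<delta>"
proof -
  define f where "f \<delta> = (if \<delta> \<in> D then p \<delta> else 0)" for \<delta>
  have nonneg: "f \<delta> \<ge> 0" for \<delta> using assms(2)[of \<delta>] by (auto simp: f_def)
  have "(\<integral>\<^sup>+ \<delta>. ennreal (f \<delta>) \<partial>count_space UNIV) = (\<Sum>\<delta>\<in>D. ennreal (f \<delta>))"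
    using assms(1) by (intro nn_integral_count_space') (auto simp: f_def)
  also have "\<dots> = ennreal (sum f D)" by (rule sum_ennreal) (rule nonneg)
  also have "sum f D = 1" using assms(3) by (simp add: f_def)
  finally have one: "(\<integral>\<^sup>+ \<delta>. ennreal (f \<delta>) \<partial>count_space UNIV) = 1" by simp
  have pmf: "pmf (embed_pmf f) \<delta> = f \<delta>" for \<delta> by (rule pmf_embed_pmf[OF nonneg one])
  show thesis
  proof
    show "embed_pmf f \<in> full_support_measures D"
      using assms(2) by (auto simp: full_support_measures_def set_pmf_iff pmf f_def split: if_splits)
    show "pmf (embed_pmf f) \<delta> = p \<delta>" if "\<delta> \<in> D" for \<delta> using that by (simp add: pmf f_def)
  qed
qed

subsection \<open>The equivalence\<close>

lemma representation_if_axioms: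
  assumes D: "finite D" "D \<subseteq> {0<..<1}" "card D \<ge> 3" and "weak_order R"
    and "D_monotonicity D R" "continuity R" "convexity R" "invariance_origin R"
      "invariance_unconcerned D R"
  shows "\<exists>\<nu>\<in>full_support_measures D. \<exists>\<sigma>>0. \<forall>x y. R x y \<longleftrightarrow>
    (\<Sum>\<delta>\<in>D. xi \<sigma> (discounted \<delta> x) * pmf \<nu> \<delta>) \<ge> (\<Sum>\<delta>\<in>D. xi \<sigma> (discounted \<delta> y) * pmf \<nu> \<delta>)"
proof -
  obtain X :: "(real \<Rightarrow> real) \<Rightarrow> linf" where X: "\<And>u \<delta>. \<delta> \<in> D \<Longrightarrow> discounted \<delta> (X u) = u \<delta>"
    and X_lin: "\<And>u v t. X (\<lambda>\<delta>. u \<delta> + t * v \<delta>) = X u + t *\<^sub>R X v"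
    using linear_interpolation_exists[OF D(1,2)] by blast
  have total: "R x y \<or> R y x" and trans: "R x y \<Longrightarrow> R y z \<Longrightarrow> R x z" for x y z
    using \<open>weak_order R\<close> unfolding weak_order_def by blast+
  have mono: "R x y" if "\<And>\<delta>. \<delta> \<in> D \<Longrightarrow> discounted \<delta> y \<le> discounted \<delta> x" for x y
    using \<open>D_monotonicity D R\<close> that unfolding D_monotonicity_def by blast
  have strict: "\<not> R y x" if "\<And>\<delta>. \<delta> \<in> D \<Longrightarrow> discounted \<delta> y \<le> discounted \<delta> x"
    "\<delta> \<in> D" "discounted \<delta> y < discounted \<delta> x" for x y \<delta>
    using \<open>D_monotonicity D R\<close> that unfolding D_monotonicity_def asym_part_def by blast
  have cong: "R x y \<longleftrightarrow> R x' y'"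
    if "\<And>\<delta>. \<delta> \<in> D \<Longrightarrow> discounted \<delta> x = discounted \<delta> x'"
      "\<And>\<delta>. \<delta> \<in> D \<Longrightarrow> discounted \<delta> y = discounted \<delta> y'" for x y x' y'
  proof -
    have "R x x'" "R x' x" "R y y'" "R y' y" by (rule mono, simp add: that)+
    then show ?thesis using trans by blast
  qed
  have closed: "closed {z. R z x}" "closed {z. R x z}" for x
    using \<open>continuity R\<close> unfolding continuity_def by blast+
  have lin: "discounted \<delta> (x + y) = discounted \<delta> x + discounted \<delta> y"
    "discounted \<delta> (r *\<^sub>R x) = r * discounted \<delta> x" if "\<delta> \<in> D" for \<delta> r x y
    using that D(2) by (auto intro!: discounted_linear)
  define P where "P u v = R (X u) (X v)" for u v
  interpret separable_preference D P
  proof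
    show "finite D" by (rule D(1))
    show "P u v \<or> P v u" for u v unfolding P_def by (rule total)
    show "P u w" if "P u v" "P v w" for u v w using that unfolding P_def by (rule trans)
    show "P u v" if "\<And>i. i \<in> D \<Longrightarrow> v i \<le> u i" for u v
      unfolding P_def by (rule mono) (simp add: X that)
    show "\<not> P v u" if "\<And>i. i \<in> D \<Longrightarrow> v i \<le> u i" "j \<in> D" "v j < u j" for u v j
      unfolding P_def by (rule strict[of _ _ j]) (simp_all add: X that)
    show "closed {t. P (\<lambda>i. u i + t * v i) w}" for u v w
    proof -
      have "closed ((\<lambda>t. X u + t *\<^sub>R X v) -` {z. R z (X w)})"
        by (intro continuous_closed_vimage closed) (auto intro!: continuous_intros)
      then show ?thesis by (simp add: P_def X_lin vimage_def)
    qed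
    show "closed {t. P w (\<lambda>i. u i + t * v i)}" for u v w
    proof -
      have "closed ((\<lambda>t. X u + t *\<^sub>R X v) -` {z. R (X w) z})"
        by (intro continuous_closed_vimage closed) (auto intro!: continuous_intros)
      then show ?thesis by (simp add: P_def X_lin vimage_def)
    qed
    show "P (\<lambda>i. \<alpha> * u i + (1 - \<alpha>) * v i) u" if "P u v" "P v u" "\<alpha> \<in> {0..1}" for u v \<alpha>
    proof -
      have "R (\<alpha> *\<^sub>R X u + (1 - \<alpha>) *\<^sub>R X v) (X u)"
        using \<open>convexity R\<close> that unfolding convexity_def sym_part_def P_def by blast
      also have "R (\<alpha> *\<^sub>R X u + (1 - \<alpha>) *\<^sub>R X v) (X u)
          \<longleftrightarrow> R (X (\<lambda>i. \<alpha> * u i + (1 - \<alpha>) * v i)) (X u)"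
        by (rule cong) (simp_all add: X lin)
      finally show ?thesis by (simp add: P_def)
    qed
    show "P (\<lambda>i. u i + c) (\<lambda>i. v i + c) \<longleftrightarrow> P u v" for u v c
    proof -
      \<comment> \<open>An amount \<open>c\<close> in period 0 has discounted value \<open>c\<close>
        under every discount factor, so origin invariance becomes translation of profiles.\<close>
      let ?z = "seq_of_poly [:c:]"
      have "?z \<in> linf0" by (auto simp: linf0_def apply_seq_of_poly coeff_pCons split: nat.splits)
      then have "R (X u) (X v) \<longleftrightarrow> R (X u + ?z) (X v + ?z)"
        using \<open>invariance_origin R\<close> unfolding invariance_origin_def by blast
      also have "\<dots> \<longleftrightarrow> R (X (\<lambda>i. u i + c)) (X (\<lambda>i. v i + c))"
        by (rule cong) (simp_all add: X lin discounted_seq_of_poly)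
      finally show ?thesis by (simp add: P_def)
    qed
    show "P u v \<longleftrightarrow> P u' v'"
      if "E \<subseteq> D" "\<And>i. i \<in> E \<Longrightarrow> u i = u' i \<and> v i = v' i"
        "\<And>i. i \<in> D - E \<Longrightarrow> u i = v i \<and> u' i = v' i" for E u v u' v'
    proof -
      have "discounted \<delta> (X u) = discounted \<delta> (X u') \<and> discounted \<delta> (X v) = discounted \<delta> (X v')"
        if "\<delta> \<in> E" for \<delta>
        using that \<open>E \<subseteq> D\<close> \<open>\<And>i. i \<in> E \<Longrightarrow> u i = u' i \<and> v i = v' i\<close>
        by (simp add: X subset_iff)
      moreover have "discounted \<delta> (X u) = discounted \<delta> (X v) \<and> discounted \<delta> (X u') = discounted \<delta> (X v')"
        if "\<delta> \<in> D - E" for \<delta>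
        using that \<open>\<And>i. i \<in> D - E \<Longrightarrow> u i = v i \<and> u' i = v' i\<close> by (simp add: X)
      ultimately show ?thesis
        using \<open>invariance_unconcerned D R\<close> \<open>E \<subseteq> D\<close> unfolding invariance_unconcerned_def P_def
        by blast
    qed
  qed
  obtain B p where "B \<ge> 0" and p: "\<And>\<delta>. \<delta> \<in> D \<Longrightarrow> p \<delta> > 0" "sum p D = 1"
    and P_iff: "\<And>u v. P u v \<longleftrightarrow> (\<Sum>i\<in>D. p i * phi B (v i)) \<le> (\<Sum>i\<in>D. p i * phi B (u i))"
    using phi_representation[OF D(3)] by blast
  define W where "W x = (\<Sum>\<delta>\<in>D. p \<delta> * phi B (discounted \<delta> x))" for x
  have R_iff: "R x y \<longleftrightarrow> W y \<le> W x" for x y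
  proof -
    have "R x y \<longleftrightarrow> P (\<lambda>\<delta>. discounted \<delta> x) (\<lambda>\<delta>. discounted \<delta> y)"
      unfolding P_def by (rule cong) (simp_all add: X)
    then show ?thesis by (simp add: P_iff W_def)
  qed
  have "B \<noteq> 0"
  proof
    assume "B = 0"
    then have W: "W x = (\<Sum>\<delta>\<in>D. p \<delta> * discounted \<delta> x)" for x by (simp add: W_def phi_def)
    have W_mix: "W (\<alpha> *\<^sub>R x + (1 - \<alpha>) *\<^sub>R y) = \<alpha> * W x + (1 - \<alpha>) * W y" for \<alpha> x y
      unfolding W sum_distrib_left sum.distrib[symmetric]
      by (rule sum.cong) (simp_all add: lin, simp add: algebra_simps)
    obtain x y \<alpha> where "sym_part R x y" "asym_part R (\<alpha> *\<^sub>R x + (1 - \<alpha>) *\<^sub>R y) x"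
      using \<open>convexity R\<close> unfolding convexity_def by blast
    then have "W x = W y" "\<not> W (\<alpha> *\<^sub>R x + (1 - \<alpha>) *\<^sub>R y) \<le> W x"
      by (auto simp: sym_part_def asym_part_def R_iff)
    then show False unfolding W_mix by (simp add: algebra_simps)
  qed
  with \<open>B \<ge> 0\<close> have "B > 0" by simp
  obtain \<nu> where \<nu>: "\<nu> \<in> full_support_measures D" "\<And>\<delta>. \<delta> \<in> D \<Longrightarrow> pmf \<nu> \<delta> = p \<delta>"
    using full_support_measure_exists[OF D(1) p] by blast
  have xi: "xi (1 / B) t = B * phi B t - 1" for t
    using \<open>B > 0\<close> by (simp add: xi_def phi_def mult.commute)
  have "(\<Sum>\<delta>\<in>D. xi (1 / B) (discounted \<delta> x) * pmf \<nu> \<delta>) = B * W x - 1" for x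
  proof -
    have "(\<Sum>\<delta>\<in>D. xi (1 / B) (discounted \<delta> x) * pmf \<nu> \<delta>)
        = (\<Sum>\<delta>\<in>D. B * (p \<delta> * phi B (discounted \<delta> x)) - p \<delta>)"
      by (rule sum.cong) (simp_all add: xi \<nu> algebra_simps)
    then show ?thesis by (simp add: sum_subtractf p(2) W_def sum_distrib_left)
  qed
  then have "\<forall>x y. R x y \<longleftrightarrow> (\<Sum>\<delta>\<in>D. xi (1 / B) (discounted \<delta> x) * pmf \<nu> \<delta>)
      \<ge> (\<Sum>\<delta>\<in>D. xi (1 / B) (discounted \<delta> y) * pmf \<nu> \<delta>)"
    using \<open>B > 0\<close> by (simp add: R_iff)
  moreover have "1 / B > 0" using \<open>B > 0\<close> by simp
  ultimately show ?thesis using \<nu>(1) by blast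
qed

section \<open>The exponential criterion satisfies the axioms\<close>

lemma xi_strict_mono: "\<sigma> > 0 \<Longrightarrow> s < t \<Longrightarrow> xi \<sigma> s < xi \<sigma> t"
  by (simp add: xi_def divide_strict_right_mono)

lemma xi_mono: "\<sigma> > 0 \<Longrightarrow> s \<le> t \<Longrightarrow> xi \<sigma> s \<le> xi \<sigma> t"
  by (simp add: xi_def divide_right_mono)

lemma xi_add: "xi \<sigma> (s + t) = exp (- t / \<sigma>) * xi \<sigma> s"
  by (simp add: xi_def add_divide_distrib diff_divide_distrib flip: exp_add)

lemma xi_concave:
  assumes "\<alpha> \<in> {0..1}"
  shows "\<alpha> * xi \<sigma> s + (1 - \<alpha>) * xi \<sigma> t \<le> xi \<sigma> (\<alpha> * s + (1 - \<alpha>) * t)"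
proof -
  have "exp (\<alpha> *\<^sub>R (- s / \<sigma>) + (1 - \<alpha>) *\<^sub>R (- t / \<sigma>))
      \<le> \<alpha> * exp (- s / \<sigma>) + (1 - \<alpha>) * exp (- t / \<sigma>)"
    using assms by (intro exp_convex[unfolded convex_on_def, THEN conjunct2, rule_format]) auto
  moreover have "\<alpha> *\<^sub>R (- s / \<sigma>) + (1 - \<alpha>) *\<^sub>R (- t / \<sigma>) = - (\<alpha> * s + (1 - \<alpha>) * t) / \<sigma>"
    by (simp add: add_divide_distrib diff_divide_distrib)
  ultimately show ?thesis unfolding xi_def by simp
qed

text \<open>With \<open>e = exp (- s / \<sigma> / 2)\<close> the gap is
  \<open>(e - 1)\<^sup>2 / 2\<close>. Midpoints suffice, as strict convexity asks for a single
  witness.\<close>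

lemma xi_half_strict:
  assumes "\<sigma> > 0" "s \<noteq> 0"
  shows "1 / 2 * xi \<sigma> s + 1 / 2 * xi \<sigma> 0 < xi \<sigma> (1 / 2 * s)"
proof -
  define e where "e = exp (- s / \<sigma> / 2)"
  have "e \<noteq> 1" using assms by (simp add: e_def)
  then have "0 < (e - 1)\<^sup>2" by simp
  moreover have "exp (- s / \<sigma>) = e * e" by (simp add: e_def exp_add[symmetric])
  moreover have "exp (- (1 / 2 * s) / \<sigma>) = e" by (simp add: e_def)
  ultimately show ?thesis by (simp add: xi_def power2_eq_square algebra_simps)
qed

lemma axioms_if_representation:
  assumes D: "finite D" "D \<subseteq> {0<..<1}" "card D \<ge> 2"
    and \<nu>: "\<nu> \<in> full_support_measures D" and \<sigma>: "\<sigma> > 0"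
    and R_xi: "\<And>x y. R x y \<longleftrightarrow>
      (\<Sum>\<delta>\<in>D. xi \<sigma> (discounted \<delta> x) * pmf \<nu> \<delta>) \<ge> (\<Sum>\<delta>\<in>D. xi \<sigma> (discounted \<delta> y) * pmf \<nu> \<delta>)"
  shows "D_monotonicity D R" "continuity R" "convexity R" "invariance_origin R"
    "invariance_unconcerned D R"
proof -
  define V where "V u = (\<Sum>\<delta>\<in>D. xi \<sigma> (u \<delta>) * pmf \<nu> \<delta>)" for u
  define W where "W x = V (\<lambda>\<delta>. discounted \<delta> x)" for x
  have R_iff: "R x y \<longleftrightarrow> W y \<le> W x" for x y unfolding R_xi W_def V_def ..
  have pos: "pmf \<nu> \<delta> > 0" if "\<delta> \<in> D" for \<delta> using \<nu> that by (simp add: full_support_measures_def)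
  have lin: "discounted \<delta> (x + y) = discounted \<delta> x + discounted \<delta> y"
    "discounted \<delta> (r *\<^sub>R x) = r * discounted \<delta> x" if "\<delta> \<in> D" for \<delta> r x y
    using that D(2) by (auto intro!: discounted_linear)
  have V_cong: "V u = V v" if "\<And>\<delta>. \<delta> \<in> D \<Longrightarrow> u \<delta> = v \<delta>" for u v
    using that by (simp add: V_def)
  have V_mono: "V u \<le> V v" if "\<And>\<delta>. \<delta> \<in> D \<Longrightarrow> u \<delta> \<le> v \<delta>" for u v
    unfolding V_def using that \<sigma> by (intro sum_mono mult_right_mono xi_mono) auto
  show "D_monotonicity D R"
    unfolding D_monotonicity_def asym_part_def R_iff not_le
  proof (intro allI impI conjI)
    fix x y assume le: "\<forall>\<delta>\<in>D. discounted \<delta> y \<le> discounted \<delta> x"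
    then show *: "W y \<le> W x" unfolding W_def by (intro V_mono) auto
    then show "W y \<le> W x" .
    assume "\<exists>\<delta>\<in>D. discounted \<delta> y < discounted \<delta> x"
    then show "W y < W x"
      unfolding W_def V_def using le pos \<sigma> D(1)
      by (intro sum_strict_mono_ex1)
        (auto intro!: mult_right_mono mult_strict_right_mono xi_mono xi_strict_mono)
  qed
  have "continuous_on UNIV (discounted \<delta>)" if "\<delta> \<in> D" for \<delta>
    using that D(2) by (intro linear_continuous_on bounded_linear_discounted) auto
  then have "continuous_on UNIV W"
    unfolding W_def V_def xi_def using \<sigma> by (auto intro!: continuous_intros)
  then show "continuity R"
    unfolding continuity_def R_iff by (auto intro!: closed_Collect_le continuous_on_const)
  have W_mix: "W (\<alpha> *\<^sub>R x + (1 - \<alpha>) *\<^sub>R y)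
      = V (\<lambda>\<delta>. \<alpha> * discounted \<delta> x + (1 - \<alpha>) * discounted \<delta> y)" for \<alpha> x y
    unfolding W_def by (rule V_cong) (simp add: lin)
  have V_concave: "\<alpha> * V u + (1 - \<alpha>) * V v \<le> V (\<lambda>\<delta>. \<alpha> * u \<delta> + (1 - \<alpha>) * v \<delta>)"
    if "\<alpha> \<in> {0..1}" for \<alpha> u v
    unfolding V_def sum_distrib_left sum.distrib[symmetric]
  proof (rule sum_mono)
    fix \<delta>
    have "(\<alpha> * xi \<sigma> (u \<delta>) + (1 - \<alpha>) * xi \<sigma> (v \<delta>)) * pmf \<nu> \<delta>
        \<le> xi \<sigma> (\<alpha> * u \<delta> + (1 - \<alpha>) * v \<delta>) * pmf \<nu> \<delta>"
      by (rule mult_right_mono[OF xi_concave[OF that]]) simp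
    then show "\<alpha> * (xi \<sigma> (u \<delta>) * pmf \<nu> \<delta>) + (1 - \<alpha>) * (xi \<sigma> (v \<delta>) * pmf \<nu> \<delta>)
        \<le> xi \<sigma> (\<alpha> * u \<delta> + (1 - \<alpha>) * v \<delta>) * pmf \<nu> \<delta>"
      by (simp add: algebra_simps)
  qed
  show "convexity R"
    unfolding convexity_def
  proof (intro conjI allI impI ballI)
    fix x y \<alpha> assume "sym_part R x y" and \<alpha>: "\<alpha> \<in> {0..1::real}"
    then have "W y = W x" by (simp add: sym_part_def R_iff)
    then have "W x = \<alpha> * W x + (1 - \<alpha>) * W y" by (simp add: algebra_simps)
    also have "\<dots> \<le> W (\<alpha> *\<^sub>R x + (1 - \<alpha>) *\<^sub>R y)"
      unfolding W_mix by (simp only: W_def V_concave[OF \<alpha>])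
    finally show "R (\<alpha> *\<^sub>R x + (1 - \<alpha>) *\<^sub>R y) x" by (simp add: R_iff)
  next
    obtain X :: "(real \<Rightarrow> real) \<Rightarrow> linf" where X: "\<And>u \<delta>. \<delta> \<in> D \<Longrightarrow> discounted \<delta> (X u) = u \<delta>"
      and "\<And>u v t. X (\<lambda>\<delta>. u \<delta> + t * v \<delta>) = X u + t *\<^sub>R X v"
      using linear_interpolation_exists[OF D(1,2)] by blast
    have W_X: "W (X u) = V u" for u unfolding W_def by (rule V_cong) (simp add: X)
    obtain a b where ab: "a \<in> D" "b \<in> D" "a \<noteq> b"
    proof -
      obtain T where "T \<subseteq> D" "card T = 2" using obtain_subset_with_card_n[OF D(3)] by metis
      then show ?thesis using that unfolding card_2_iff by blast
    qed
    \<comment> \<open>The profile \<open>u\<close> below has utility \<open>-c\<close> at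
      \<open>a\<close>, \<open>-e\<close> at \<open>b\<close> and \<open>-1\<close> elsewhere, as
      \<open>- \<sigma> * ln c\<close> inverts \<open>xi\<close>. The loss
      \<open>(c - 1) * pmf \<nu> a\<close> equals the gain \<open>(1 - e) * pmf \<nu> b\<close>, so
      \<open>u\<close> is indifferent to 0. Halving keeps \<open>e\<close> positive, as its
      logarithm requires.\<close>
    define c where "c = 1 + pmf \<nu> b / 2"
    define e where "e = 1 - pmf \<nu> a / 2"
    have c: "c > 0" "c \<noteq> 1" using pos[OF ab(2)] by (simp_all add: c_def)
    have e: "e > 0" using pmf_le_1[of \<nu> a] by (simp add: e_def)
    define u where "u \<delta> = (if \<delta> = a then - \<sigma> * ln c else if \<delta> = b then - \<sigma> * ln e else 0)" for \<delta>
    have ua: "u a \<noteq> 0" using \<sigma> c by (simp add: u_def)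
    have xi_u: "xi \<sigma> (u a) = - c" "xi \<sigma> (u b) = - e" "\<And>\<delta>. \<delta> \<noteq> a \<Longrightarrow> \<delta> \<noteq> b \<Longrightarrow> xi \<sigma> (u \<delta>) = -1"
      using ab(3) \<sigma> c e by (auto simp: u_def xi_def)
    have split: "V v = xi \<sigma> (v a) * pmf \<nu> a + (xi \<sigma> (v b) * pmf \<nu> b
        + (\<Sum>\<delta>\<in>D - {a} - {b}. xi \<sigma> (v \<delta>) * pmf \<nu> \<delta>))" for v
    proof -
      have "V v = xi \<sigma> (v a) * pmf \<nu> a + (\<Sum>\<delta>\<in>D - {a}. xi \<sigma> (v \<delta>) * pmf \<nu> \<delta>)"
        unfolding V_def by (rule sum.remove[OF D(1) ab(1)])
      also have "(\<Sum>\<delta>\<in>D - {a}. xi \<sigma> (v \<delta>) * pmf \<nu> \<delta>)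
          = xi \<sigma> (v b) * pmf \<nu> b + (\<Sum>\<delta>\<in>D - {a} - {b}. xi \<sigma> (v \<delta>) * pmf \<nu> \<delta>)"
        by (rule sum.remove) (use D(1) ab in auto)
      finally show ?thesis .
    qed
    have "V u = V (\<lambda>_. 0)"
    proof -
      have "(\<Sum>\<delta>\<in>D - {a} - {b}. xi \<sigma> (u \<delta>) * pmf \<nu> \<delta>)
          = (\<Sum>\<delta>\<in>D - {a} - {b}. xi \<sigma> 0 * pmf \<nu> \<delta>)"
        by (rule sum.cong) (simp_all add: xi_u, simp add: xi_def)
      then show ?thesis unfolding split xi_u
        by (simp add: xi_def c_def e_def algebra_simps)
    qed
    then have "sym_part R (X u) (X (\<lambda>_. 0))" by (simp add: sym_part_def R_iff W_X)
    moreover have "asym_part R ((1 / 2) *\<^sub>R X u + (1 - 1 / 2) *\<^sub>R X (\<lambda>_. 0)) (X u)"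
    proof -
      let ?m = "(1 / 2) *\<^sub>R X u + (1 - 1 / 2) *\<^sub>R X (\<lambda>_. 0)"
      have "W (X u) = 1 / 2 * V u + 1 / 2 * V (\<lambda>_. 0)"
        using \<open>V u = V (\<lambda>_. 0)\<close> by (simp add: W_X)
      also have "\<dots> = (\<Sum>\<delta>\<in>D. (1 / 2 * xi \<sigma> (u \<delta>) + 1 / 2 * xi \<sigma> 0) * pmf \<nu> \<delta>)"
        unfolding V_def sum_distrib_left sum.distrib[symmetric]
        by (rule sum.cong) (simp_all add: algebra_simps)
      also have "\<dots> < V (\<lambda>\<delta>. 1 / 2 * u \<delta>)"
        unfolding V_def
      proof (rule sum_strict_mono_ex1[OF D(1)])
        have "1 / 2 * xi \<sigma> t + 1 / 2 * xi \<sigma> 0 \<le> xi \<sigma> (1 / 2 * t)" for t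
          using xi_half_strict[OF \<sigma>, of t] by (cases "t = 0") auto
        then show "\<forall>\<delta>\<in>D. (1 / 2 * xi \<sigma> (u \<delta>) + 1 / 2 * xi \<sigma> 0) * pmf \<nu> \<delta>
            \<le> xi \<sigma> (1 / 2 * u \<delta>) * pmf \<nu> \<delta>"
          by (auto intro!: mult_right_mono simp del: times_divide_eq_left)
        show "\<exists>\<delta>\<in>D. (1 / 2 * xi \<sigma> (u \<delta>) + 1 / 2 * xi \<sigma> 0) * pmf \<nu> \<delta>
            < xi \<sigma> (1 / 2 * u \<delta>) * pmf \<nu> \<delta>"
          using xi_half_strict[OF \<sigma> ua] pos[OF ab(1)] ab(1)
          by (intro bexI[of _ a] mult_strict_right_mono)
      qed
      also have "V (\<lambda>\<delta>. 1 / 2 * u \<delta>) = W ?m"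
        unfolding W_mix by (rule V_cong) (simp add: X)
      finally show ?thesis by (simp add: asym_part_def R_iff)
    qed
    ultimately show "\<exists>x' y'. sym_part R x' y' \<and>
        (\<exists>\<alpha>\<in>{0<..<1}. asym_part R (\<alpha> *\<^sub>R x' + (1 - \<alpha>) *\<^sub>R y') x')"
      by (intro exI conjI bexI[of _ "1 / 2"]) auto
  qed
  show "invariance_origin R"
    unfolding invariance_origin_def
  proof (intro allI ballI)
    fix x y z assume "z \<in> linf0"
    define c where "c = apply_bcontfun z 0"
    have "discounted \<delta> z = c" for \<delta>
    proof -
      have "discounted \<delta> z = (\<Sum>t\<in>{0}. \<delta> ^ t * apply_bcontfun z t)"
        unfolding discounted_def
        by (rule suminf_finite) (use \<open>z \<in> linf0\<close> in \<open>auto simp: linf0_def\<close>)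
      then show ?thesis by (simp add: c_def)
    qed
    \<comment> \<open>A common translation multiplies every exponential by the same positive factor,
      which preserves the order.\<close>
    then have "W (x + z) = exp (- c / \<sigma>) * W x" for x
      unfolding W_def V_def sum_distrib_left
      by (intro sum.cong) (simp_all add: lin xi_add)
    then show "R x y \<longleftrightarrow> R (x + z) (y + z)" by (simp add: R_iff)
  qed
  show "invariance_unconcerned D R"
    unfolding invariance_unconcerned_def
  proof (intro allI impI)
    fix x y x' y' E
    assume "E \<subseteq> D" and *: "(\<forall>\<delta>\<in>E. discounted \<delta> x = discounted \<delta> x' \<and> discounted \<delta> y = discounted \<delta> y')
      \<and> (\<forall>\<delta>\<in>D - E. discounted \<delta> x = discounted \<delta> y \<and> discounted \<delta> x' = discounted \<delta> y')"
    define S where "S A x = (\<Sum>\<delta>\<in>A. xi \<sigma> (discounted \<delta> x) * pmf \<nu> \<delta>)" for A x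
    have W: "W x = S (D - E) x + S E x" for x
      unfolding W_def V_def S_def by (rule sum.subset_diff[OF \<open>E \<subseteq> D\<close> D(1)])
    have "S E x = S E x'" "S E y = S E y'" "S (D - E) x = S (D - E) y" "S (D - E) x' = S (D - E) y'"
      unfolding S_def using * by (auto intro!: sum.cong)
    then show "R x y \<longleftrightarrow> R x' y'" by (simp add: R_iff W)
  qed
qed

theorem proposition4p1:
  fixes N :: nat and d :: "nat \<Rightarrow> real" and D :: "real set" and R :: "linf \<Rightarrow> linf \<Rightarrow> bool"
  assumes "N \<ge> 3"
    and "D = d ` {1..N}"
    and "D \<subseteq> {0<..<1}"
    and "inj_on d {1..N}"
    and "weak_order R"
  shows "(D_monotonicity D R \<and> continuity R \<and> convexity R \<and> invariance_origin R \<and>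
            invariance_unconcerned D R)
     \<longleftrightarrow>
     (\<exists>\<nu>\<in>full_support_measures D. \<exists>\<sigma>>0. \<forall>x y.
        R x y \<longleftrightarrow>
          (\<Sum>\<delta>\<in>D. xi \<sigma> (discounted \<delta> x) * pmf \<nu> \<delta>)
            \<ge> (\<Sum>\<delta>\<in>D. xi \<sigma> (discounted \<delta> y) * pmf \<nu> \<delta>))"
    (is "?axioms \<longleftrightarrow> ?representation")
proof -
  have "finite D" using assms(2) by simp
  have "card D = N" using assms(2,4) by (simp add: card_image)
  show ?thesis
  proof
    assume ?axioms
    then show ?representation
      using assms(1,3,5) \<open>finite D\<close> \<open>card D = N\<close> by (intro representation_if_axioms) auto
  next
    assume ?representation
    then obtain \<nu> \<sigma> where r: "\<nu> \<in> full_support_measures D" "\<sigma> > 0"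
      "\<And>x y. R x y \<longleftrightarrow> (\<Sum>\<delta>\<in>D. xi \<sigma> (discounted \<delta> x) * pmf \<nu> \<delta>)
        \<ge> (\<Sum>\<delta>\<in>D. xi \<sigma> (discounted \<delta> y) * pmf \<nu> \<delta>)"
      by blast
    have "card D \<ge> 2" using assms(1) \<open>card D = N\<close> by simp
    from axioms_if_representation[OF \<open>finite D\<close> assms(3) this r] show ?axioms
      by (intro conjI)
  qed
qed

end
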